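(* Let $n \geq 5$ be an integer with $n \neq 28$. If a regular $n$-gon can be tiled with similar right triangles, then the smaller angle of these triangles belongs to $\left\{\frac{\pi}{n},\frac{2\pi}{n}, \frac{\pi}{6}+\frac{2\pi}{3n}\right\}$.
   Context: A tiling of a polygon is a decomposition of it into finitely many non-overlapping triangles; it need not be a triangulation, i.e. a vertex of one triangle may lie on a side of another triangle. "Tiled with similar right triangles" means all triangles in the tiling are right triangles similar to one another, with angles $\alpha$, $\frac{\pi}{2}-\alpha$, $\frac{\pi}{2}$ where $0<\alpha\le\frac{\pi}{4}$; the smaller angle means $\alpha$. *)

theory Defs
  imports "HOL-Analysis.Analysis"
begin

text \<open>The Euclidean plane is modelled by the type \<^typ>\<open>complex\<close>.\<close>

definition angle_at :: "complex \<Rightarrow> complex \<Rightarrow> complex \<Rightarrow> real" where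
  \<comment> \<open>the unoriented angle at \<open>b\<close> between the rays towards \<open>a\<close> and \<open>c\<close>\<close>
  "angle_at a b c = arccos (((a - b) \<bullet> (c - b)) / (norm (a - b) * norm (c - b)))"

definition is_triangle :: "complex set \<Rightarrow> bool" where
  "is_triangle S \<longleftrightarrow> (\<exists>a b c. \<not> collinear {a, b, c} \<and> S = convex hull {a, b, c})"

definition has_triangle_angles :: "complex set \<Rightarrow> real \<Rightarrow> real \<Rightarrow> real \<Rightarrow> bool" where
  "has_triangle_angles S \<alpha> \<beta> \<gamma> \<longleftrightarrow>
     (\<exists>a b c. \<not> collinear {a, b, c} \<and> S = convex hull {a, b, c} \<and>
        angle_at b a c = \<alpha> \<and> angle_at a b c = \<beta> \<and> angle_at a c b = \<gamma>)"

text \<open>Similarities may reverse orientation.\<close>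

definition similar :: "complex set \<Rightarrow> complex set \<Rightarrow> bool" where
  "similar S S' \<longleftrightarrow>
     (\<exists>f k. k > 0 \<and> (\<forall>x y. dist (f x) (f y) = k * dist x y) \<and> S' = f ` S)"

text \<open>A regular \<open>n\<close>-gon, as a region, with centre \<open>z\<close> and arbitrary size and orientation
  (both encoded in \<open>w\<close>).\<close>

definition is_regular_ngon :: "nat \<Rightarrow> complex set \<Rightarrow> bool" where
  "is_regular_ngon n P \<longleftrightarrow>
     (\<exists>z w. w \<noteq> 0 \<and> P = convex hull ((\<lambda>k. z + w * cis (2 * pi * real k / real n)) ` {..<n}))"

text \<open>The tiles need not meet edge to edge.\<close>

definition is_tiling :: "complex set \<Rightarrow> complex set set \<Rightarrow> bool" where
  "is_tiling P T \<longleftrightarrow>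
     finite T \<and> (\<forall>S\<in>T. is_triangle S) \<and>
     (\<forall>S\<in>T. \<forall>S'\<in>T. S \<noteq> S' \<longrightarrow> interior S \<inter> interior S' = {}) \<and>
     \<Union>T = P"

definition similar_right_triangles :: "complex set set \<Rightarrow> real \<Rightarrow> bool" where
  \<comment> \<open>\<open>\<alpha>\<close> is the smaller angle\<close>
  "similar_right_triangles T \<alpha> \<longleftrightarrow>
     0 < \<alpha> \<and> \<alpha> \<le> pi / 4 \<and>
     (\<forall>S\<in>T. \<forall>S'\<in>T. similar S S') \<and>
     (\<forall>S\<in>T. has_triangle_angles S \<alpha> (pi / 2 - \<alpha>) (pi / 2))"

end

theory Submission
  imports Defs
begin

text \<open>
  At each point the angles of the tiles add up to the angle of the polygon there.  Each tile has one angle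
  \<open>\<alpha>\<close> and one angle \<open>\<beta> = pi / 2 - \<alpha>\<close>.  A corner of the polygon with more
  \<open>\<beta>\<close> than \<open>\<alpha>\<close> forces one of the three values.  If every corner has more
  \<open>\<alpha>\<close>, then another point has more \<open>\<beta>\<close>; the two resulting equations leave only
  \<open>n = 5\<close> and \<open>n = 7\<close> with \<open>\<beta> = 2 * pi / n\<close> (and the excluded \<open>n = 28\<close>)
  besides the three values.

  In these cases let \<open>\<zeta> = cis (2 * pi / n)\<close>.  All edges of tiles are real multiples of vectors of
  \<open>\<rat>(\<i>, \<zeta>)\<close>, so an additive map \<open>G\<close> of the plane that commutes with \<open>\<i>\<close> and
  conjugation and satisfies \<open>G (\<zeta> * x) = \<zeta> ^ j * G x\<close> preserves additivity of signed areas.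
  It maps the polygon to a multiple of a star polygon of signed area
  \<open>n / 2 * sin (2 * pi * j / n)\<close>, and each tile to a right triangle whose signed area has the sign of \<open>tan (2 * pi * j / n)\<close> or is zero.  For
  \<open>2 \<le> j \<le> n - 2\<close> these signs differ.
\<close>

text \<open>Angle counts alone cannot exclude \<open>n = 5\<close> and \<open>n = 7\<close> with
  \<beta> = \<open>2 * pi / n\<close>: the equations at a corner and at a point with more \<beta>
  than \<alpha> are both solvable there. An area argument is needed, but \<open>G\<close> is
  additive without being continuous, so the images of tiles may overlap and cannot be compared
  geometrically. Area is therefore written as a sum over vertices. The twist of a tile vanishes away
  from its vertices, and at each point the twists of the tiles add up to that of the polygon, even
  where a vertex of one tile lies inside a side of another. These are finitely many additive
  identities between complex numbers, which \<open>G\<close> respects. They become areas again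
  through \<open>kap d * d = cnj d\<close>: for an edge \<open>d\<close>, \<open>kap d\<close> is,
  up to one common factor, plus or minus a power of \<zeta>, and multiplication by such powers
  passes through \<open>G\<close>. Angle and twist are integrals of two weights over the directions
  at a point, so one additivity proof serves both.\<close>

text \<open>A cone starts at an arbitrary direction, while \<open>local_int\<close> uses the fixed
  period from 0. Shifting by a multiple of \<open>p\<close> puts the left end into
  \<open>{0..p}\<close>; the part beyond \<open>p\<close> is then moved back by one period.\<close>

lemma has_integral_periodic:
  fixes F :: "real \<Rightarrow> complex"
  assumes per: "\<And>x. F (x + p) = F x" and "p > 0"
    and int: "(F has_integral I) {c..c + p}"
  shows "(F has_integral I) {0..p}"
proof -
  have per_nat: "F (x + real k * p) = F x" for k x
  proof (induction k)
    case (Suc k)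
    then show ?case using per[of "x + real k * p"] by (simp add: algebra_simps)
  qed simp
  have per_int: "F (x + of_int k * p) = F x" for k x
  proof (cases "k \<ge> 0")
    case True
    then show ?thesis using per_nat[of x "nat k"] by simp
  next
    case False
    then show ?thesis using per_nat[of "x + of_int k * p" "nat (-k)"] by simp
  qed
  define m where "m = \<lfloor>c / p\<rfloor>"
  define d where "d = c - of_int m * p"
  have "of_int m \<le> c / p" "c / p < of_int m + 1"
    unfolding m_def by linarith+
  with \<open>p > 0\<close> have d: "0 \<le> d" "d \<le> p"
    by (simp_all add: d_def field_simps)
  have "((\<lambda>x. F (x + of_int m * p)) has_integral I) {c - of_int m * p..c + p - of_int m * p}"
    by (rule has_integral_shift_real_ivl[OF int])
  then have intd: "(F has_integral I) {d..d + p}"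
    unfolding per_int by (simp add: d_def algebra_simps)
  have "F integrable_on {d..d + p}" using intd by (rule has_integral_integrable)
  then have "F integrable_on {d..p}" "F integrable_on {p..d + p}"
    using d integrable_on_subinterval[of F "{d..d + p}"] by auto
  then obtain I1 I2 where I1: "(F has_integral I1) {d..p}" and I2: "(F has_integral I2) {p..d + p}"
    by (meson integrable_integral)
  have "(F has_integral I1 + I2) {d..d + p}"
    using d by (intro has_integral_combine[OF _ _ I1 I2]) auto
  then have I: "I = I1 + I2"
    using intd has_integral_unique by blast
  have "((\<lambda>x. F (x + p)) has_integral I2) {p - p..d + p - p}"
    by (rule has_integral_shift_real_ivl[OF I2])
  then have "(F has_integral I2) {0..d}"
    by (simp add: per)
  then have "(F has_integral I2 + I1) {0..p}"
    using d by (intro has_integral_combine[OF _ _ _ I1]) auto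
  then show ?thesis by (simp add: I add.commute)
qed

section \<open>Local cones and additivity over tilings\<close>

text \<open>Together with \<open>off_ray\<close> this describes the germ of \<open>X\<close> at
  \<open>v\<close> in one direction. The two are not complementary, since a ray can enter and leave
  \<open>X\<close> arbitrarily close to \<open>v\<close>; for a cone they cover all but the two
  bounding directions.\<close>

definition near_ray :: "complex set \<Rightarrow> complex \<Rightarrow> real \<Rightarrow> bool" where
  "near_ray X v \<theta> \<longleftrightarrow> (\<forall>\<^sub>F r in at_right 0. v + of_real r * cis \<theta> \<in> X)"

definition off_ray :: "complex set \<Rightarrow> complex \<Rightarrow> real \<Rightarrow> bool" where
  "off_ray X v \<theta> \<longleftrightarrow> (\<forall>\<^sub>F r in at_right 0. v + of_real r * cis \<theta> \<notin> X)"

text \<open>Nothing is said about the two bounding directions, which do not affect integrals. The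
  inner condition uses the interior, so that two tiles never claim the same direction. For
  \<open>A = 2 * pi\<close> the outer condition is empty.\<close>

definition cone_at :: "complex set \<Rightarrow> complex \<Rightarrow> real \<Rightarrow> real \<Rightarrow> bool" where
  "cone_at X v \<phi> A \<longleftrightarrow> 0 < A \<and> A \<le> 2 * pi \<and>
     (\<forall>\<theta>. \<phi> < \<theta> \<and> \<theta> < \<phi> + A \<longrightarrow> near_ray (interior X) v \<theta>) \<and>
     (\<forall>\<theta>. \<phi> + A < \<theta> \<and> \<theta> < \<phi> + 2 * pi \<longrightarrow> off_ray X v \<theta>)"

definition local_int :: "(real \<Rightarrow> complex) \<Rightarrow> complex set \<Rightarrow> complex \<Rightarrow> complex" where
  "local_int h X v = integral {0..2 * pi} (\<lambda>\<theta>. if near_ray X v \<theta> then h \<theta> else 0)"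

lemma not_near_off:
  assumes "near_ray X v \<theta>" "off_ray X v \<theta>"
  shows False
proof -
  have "\<forall>\<^sub>F r in at_right (0::real). False"
    using assms unfolding near_ray_def off_ray_def by eventually_elim simp
  then show False by simp
qed

lemma off_not_near: "off_ray X v \<theta> \<Longrightarrow> \<not> near_ray X v \<theta>"
  using not_near_off by blast

lemma near_ray_mono: "near_ray X v \<theta> \<Longrightarrow> X \<subseteq> Y \<Longrightarrow> near_ray Y v \<theta>"
  unfolding near_ray_def by (auto elim: eventually_mono)

lemma near_ray_disjoint:
  assumes "near_ray X v \<theta>" "near_ray Y v \<theta>" "X \<inter> Y = {}"
  shows False
proof -
  have "off_ray Y v \<theta>" using assms(1,3)
    unfolding near_ray_def off_ray_def by (auto elim: eventually_mono)
  with assms(2) show False by (rule not_near_off)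
qed

lemma near_ray_cis: "cis \<theta> = cis \<theta>' \<Longrightarrow> near_ray X v \<theta> = near_ray X v \<theta>'"
  unfolding near_ray_def by simp

text \<open>The fundamental theorem applies on the sector, the integrand is zero on the rest of the
  turn, and periodicity moves the interval. The result is a difference of values of
  \<open>H\<close>, which need not be periodic: for the angle it is the identity.\<close>

lemma local_int_eqI:
  fixes h H :: "real \<Rightarrow> complex"
  assumes cone: "cone_at X v \<phi> A"
    and per: "\<And>x. h (x + 2 * pi) = h x"
    and deriv: "\<And>x. (H has_vector_derivative h x) (at x)"
  shows "((\<lambda>\<theta>. if near_ray X v \<theta> then h \<theta> else 0) has_integral (H (\<phi> + A) - H \<phi>)) {0..2 * pi}"
proof -
  let ?F = "\<lambda>\<theta>. if near_ray X v \<theta> then h \<theta> else 0"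
  have A: "0 < A" "A \<le> 2 * pi"
    using cone unfolding cone_at_def by auto
  have 1: "(?F has_integral (H (\<phi> + A) - H \<phi>)) {\<phi>..\<phi> + A}"
  proof (rule has_integral_spike_finite[where S = "{\<phi>, \<phi> + A}"])
    show "(h has_integral (H (\<phi> + A) - H \<phi>)) {\<phi>..\<phi> + A}"
      using A deriv by (intro fundamental_theorem_of_calculus)
        (auto intro: has_vector_derivative_at_within)
    fix x assume "x \<in> {\<phi>..\<phi> + A} - {\<phi>, \<phi> + A}"
    then have "near_ray X v x"
      using cone near_ray_mono[OF _ interior_subset] unfolding cone_at_def by auto
    then show "?F x = h x" by simp
  qed simp
  have 2: "(?F has_integral 0) {\<phi> + A..\<phi> + 2 * pi}"
  proof (rule has_integral_spike_finite[where S = "{\<phi> + A, \<phi> + 2 * pi}"])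
    show "((\<lambda>x. 0) has_integral (0::complex)) {\<phi> + A..\<phi> + 2 * pi}" by simp
    fix x assume "x \<in> {\<phi> + A..\<phi> + 2 * pi} - {\<phi> + A, \<phi> + 2 * pi}"
    then have "off_ray X v x"
      using cone unfolding cone_at_def by auto
    then show "?F x = 0" by (simp add: off_not_near)
  qed simp
  have "(?F has_integral (H (\<phi> + A) - H \<phi> + 0)) {\<phi>..\<phi> + 2 * pi}"
    using A by (intro has_integral_combine[OF _ _ 1 2]) auto
  moreover have "near_ray X v (x + 2 * pi) = near_ray X v x" for x
    by (intro near_ray_cis) (simp add: cis.ctr)
  ultimately show ?thesis
    by (intro has_integral_periodic[where c = \<phi>]) (simp_all add: per)
qed

lemma local_int_cone:
  fixes h H :: "real \<Rightarrow> complex"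
  assumes "cone_at X v \<phi> A" "\<And>x. h (x + 2 * pi) = h x"
    and "\<And>x. (H has_vector_derivative h x) (at x)"
  shows "local_int h X v = H (\<phi> + A) - H \<phi>"
  unfolding local_int_def using local_int_eqI[OF assms] by (rule integral_unique)

lemma off_ray_outside:
  assumes "closed X" "v \<notin> X"
  shows "off_ray X v \<theta>"
proof -
  have "((\<lambda>r. v + of_real r * cis \<theta>) \<longlongrightarrow> v + of_real 0 * cis \<theta>) (at_right 0)"
    by (intro tendsto_intros)
  then have "\<forall>\<^sub>F r in at_right 0. v + of_real r * cis \<theta> \<in> - X"
    using assms by (intro topological_tendstoD) auto
  then show ?thesis unfolding off_ray_def by simp
qed

lemma finite_cis_eq: "finite {\<theta> \<in> {0..2 * pi}. cis \<theta> = u}"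
proof (rule finite_subset)
  show "{\<theta> \<in> {0..2 * pi}. cis \<theta> = u} \<subseteq> {2 * pi, Arg2pi u}"
  proof
    fix \<theta> assume "\<theta> \<in> {\<theta> \<in> {0..2 * pi}. cis \<theta> = u}"
    then have \<theta>: "0 \<le> \<theta>" "\<theta> \<le> 2 * pi" "cis \<theta> = u" by auto
    have "\<theta> = Arg2pi u" if "\<theta> < 2 * pi"
      using Arg2pi_unique[of 1 \<theta> u] \<theta> that by (simp add: cis_conv_exp)
    then show "\<theta> \<in> {2 * pi, Arg2pi u}" using \<theta>(2) by force
  qed
qed simp

lemma cone_at_dichotomy:
  assumes "cone_at X v \<phi> A" "cis \<theta> \<noteq> cis \<phi>" "cis \<theta> \<noteq> cis (\<phi> + A)"
  shows "near_ray (interior X) v \<theta> \<or> off_ray X v \<theta>"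
proof -
  define m where "m = \<lfloor>(\<theta> - \<phi>) / (2 * pi)\<rfloor>"
  define t where "t = \<theta> - of_int m * (2 * pi)"
  have "of_int m \<le> (\<theta> - \<phi>) / (2 * pi)" "(\<theta> - \<phi>) / (2 * pi) < of_int m + 1"
    unfolding m_def by linarith+
  then have t: "\<phi> \<le> t" "t < \<phi> + 2 * pi"
    using pi_gt_zero by (simp_all add: t_def field_simps)
  have "cis (of_int m * (2 * pi)) = 1"
    by (metis cis_multiple_2pi Ints_of_int mult.commute)
  then have "cis (t + of_int m * (2 * pi)) = cis t"
    unfolding cis_mult[symmetric] by simp
  then have c: "cis t = cis \<theta>"
    by (simp add: t_def)
  have "t \<noteq> \<phi>" "t \<noteq> \<phi> + A" using assms c by auto
  then have "near_ray (interior X) v t \<or> off_ray X v t"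
    using t assms(1) unfolding cone_at_def by (metis antisym_conv3 order_le_less)
  then show ?thesis unfolding near_ray_def off_ray_def c .
qed

text \<open>Away from finitely many directions each tile either contains the start of the ray in its
  interior or misses it. Disjoint interiors allow at most one tile of the first kind; if there is
  none, finiteness of \<open>T\<close> makes the ray miss the whole union. So the integrands agree
  off a finite set, however the tiles meet.\<close>

lemma local_int_tiling:
  fixes h H :: "real \<Rightarrow> complex"
  assumes fin: "finite T" and P: "\<Union>T = P"
    and disj: "\<And>S S'. S \<in> T \<Longrightarrow> S' \<in> T \<Longrightarrow> S \<noteq> S' \<Longrightarrow> interior S \<inter> interior S' = {}"
    and clo: "\<And>S. S \<in> T \<Longrightarrow> closed S"
    and cone: "\<And>S. S \<in> T \<Longrightarrow> v \<in> S \<Longrightarrow> \<exists>\<phi> A. cone_at S v \<phi> A"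
    and per: "\<And>x. h (x + 2 * pi) = h x"
    and deriv: "\<And>x. (H has_vector_derivative h x) (at x)"
  shows "local_int h P v = (\<Sum>S\<in>T. local_int h S v)"
proof -
  let ?F = "\<lambda>S \<theta>. if near_ray S v \<theta> then h \<theta> else 0"
  define \<phi> where "\<phi> S = (SOME \<phi>. \<exists>A. cone_at S v \<phi> A)" for S
  define A where "A S = (SOME A. cone_at S v (\<phi> S) A)" for S
  have cone': "cone_at S v (\<phi> S) (A S)" if "S \<in> T" "v \<in> S" for S
  proof -
    have "\<exists>A. cone_at S v (\<phi> S) A"
      unfolding \<phi>_def by (rule someI_ex) (rule cone[OF that])
    then show ?thesis unfolding A_def by (rule someI_ex)
  qed
  have int: "(?F S has_integral local_int h S v) {0..2 * pi}" if "S \<in> T" for S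
  proof (cases "v \<in> S")
    case True
    note c = cone'[OF that True]
    show ?thesis
      unfolding local_int_cone[where h = h and H = H, OF c per deriv]
      by (rule local_int_eqI[OF c per deriv])
  next
    case False
    have 0: "?F S = (\<lambda>_. 0)"
      using off_not_near[OF off_ray_outside[OF clo[OF that] False]] by auto
    show ?thesis unfolding local_int_def 0 by simp
  qed
  \<comment> \<open>For a tile that misses \<open>v\<close> the values \<open>\<phi> S\<close> and
    \<open>A S\<close> are arbitrary; this only adds finitely many directions to
    \<open>B\<close>.\<close>
  define B where "B = (\<Union>S\<in>T. {\<theta> \<in> {0..2 * pi}. cis \<theta> = cis (\<phi> S)} \<union>
                               {\<theta> \<in> {0..2 * pi}. cis \<theta> = cis (\<phi> S + A S)})"
  have "finite B"
    unfolding B_def using fin finite_cis_eq by auto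
  have "?F P \<theta> = (\<Sum>S\<in>T. ?F S \<theta>)" if "\<theta> \<in> {0..2 * pi} - B" for \<theta>
  proof -
    have dich: "near_ray (interior S) v \<theta> \<or> off_ray S v \<theta>" if S: "S \<in> T" for S
    proof (cases "v \<in> S")
      case True
      show ?thesis
        using cone_at_dichotomy[OF cone'[OF S True], of \<theta>] S \<open>\<theta> \<in> _\<close>
        unfolding B_def by blast
    next
      case False
      then show ?thesis using off_ray_outside[OF clo[OF S]] by auto
    qed
    show ?thesis
    proof (cases "\<exists>S\<in>T. near_ray (interior S) v \<theta>")
      case True
      then obtain S where S: "S \<in> T" "near_ray (interior S) v \<theta>" by blast
      have nS: "near_ray S v \<theta>" using S near_ray_mono interior_subset by blast
      have "near_ray P v \<theta>" using nS S(1) P near_ray_mono by blast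
      have "?F S' \<theta> = 0" if "S' \<in> T - {S}" for S'
      proof -
        have "off_ray S' v \<theta>"
          using near_ray_disjoint[OF S(2)] disj[OF S(1), of S'] dich[of S'] that by blast
        then show ?thesis by (simp add: off_not_near)
      qed
      then have "(\<Sum>S\<in>T - {S}. ?F S \<theta>) = 0" by (rule sum.neutral[rule_format])
      then have "(\<Sum>S\<in>T. ?F S \<theta>) = ?F S \<theta>"
        unfolding sum.remove[OF fin S(1), of "\<lambda>S. ?F S \<theta>"] by simp
      then show ?thesis using nS \<open>near_ray P v \<theta>\<close> by simp
    next
      case False
      then have off: "off_ray S v \<theta>" if "S \<in> T" for S using dich that by blast
      then have "\<forall>\<^sub>F r in at_right 0. \<forall>S\<in>T. v + of_real r * cis \<theta> \<notin> S"
        unfolding off_ray_def using fin by (simp add: eventually_ball_finite)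
      then have "off_ray P v \<theta>"
        unfolding off_ray_def P[symmetric] by simp
      then show ?thesis using off by (simp add: off_not_near)
    qed
  qed
  moreover have "((\<lambda>\<theta>. \<Sum>S\<in>T. ?F S \<theta>) has_integral (\<Sum>S\<in>T. local_int h S v)) {0..2 * pi}"
    by (intro has_integral_sum fin int)
  ultimately have "(?F P has_integral (\<Sum>S\<in>T. local_int h S v)) {0..2 * pi}"
    by (intro has_integral_spike_finite[OF \<open>finite B\<close>,
          of _ "?F P" "\<lambda>\<theta>. \<Sum>S\<in>T. ?F S \<theta>"])
  then show ?thesis unfolding local_int_def by (rule integral_unique)
qed

section \<open>Angle and twist as integrals over directions\<close>

definition local_angle :: "complex set \<Rightarrow> complex \<Rightarrow> complex" where
  "local_angle = local_int (\<lambda>_. 1)"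

text \<open>At a corner spanned counterclockwise from \<open>d\<close> to \<open>d'\<close> the twist is
  \<open>cnj d' / d' - cnj d / d\<close>.  It vanishes at interior points and inside edges, and the sum of
  \<open>twist(v) * v\<^sup>2\<close> over the vertices of a polygon is \<open>-4 * \<i>\<close> times its area.\<close>

definition local_twist :: "complex set \<Rightarrow> complex \<Rightarrow> complex" where
  "local_twist = local_int (\<lambda>\<theta>. - 2 * \<i> * cis (- 2 * \<theta>))"

lemma has_vector_derivative_cis_double:
  "((\<lambda>\<theta>. cis (- 2 * \<theta>)) has_vector_derivative - 2 * \<i> * cis (- 2 * x)) (at x)"
proof -
  have "((\<lambda>\<theta>. cis (- 2 * \<theta>)) has_derivative (\<lambda>t. (- 2 * t) *\<^sub>R (\<i> * cis (- 2 * x)))) (at x)"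
  proof (rule has_derivative_cis)
    show "((\<lambda>\<theta>. - 2 * \<theta>) has_derivative (\<lambda>t. - 2 * t)) (at x)"
      by (auto intro!: derivative_eq_intros)
  qed
  then show ?thesis
    unfolding has_vector_derivative_def
    by (rule has_derivative_eq_rhs) (auto simp: scaleR_conv_of_real)
qed

text \<open>The period is \<open>pi\<close>, not just \<open>2 * pi\<close>; this is why the twist
  vanishes at a point inside an edge.\<close>

lemma cis_double_periodic_pi: "cis (- 2 * (x + pi)) = cis (- 2 * x)"
proof -
  have "cis (- 2 * (x + pi)) = cis (- 2 * x) * cis (2 * pi * (- 1))"
    by (simp only: cis_mult) (simp add: algebra_simps)
  also have "cis (2 * pi * (- 1)) = 1" by (rule cis_multiple_2pi) simp
  finally show ?thesis by simp
qed

lemma cis_double_periodic: "cis (- 2 * (x + 2 * pi)) = cis (- 2 * x)"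
  using cis_double_periodic_pi[of x] cis_double_periodic_pi[of "x + pi"]
  by (simp add: add.assoc)

lemma local_angle_cone: "cone_at X v \<phi> A \<Longrightarrow> local_angle X v = of_real A"
  unfolding local_angle_def
  using local_int_cone[of X v \<phi> A "\<lambda>_. 1" of_real]
  by (auto intro!: derivative_eq_intros simp: has_vector_derivative_def scaleR_conv_of_real)

lemma local_twist_cone:
  assumes "cone_at X v \<phi> A"
  shows "local_twist X v = cis (- 2 * (\<phi> + A)) - cis (- 2 * \<phi>)"
  unfolding local_twist_def
  by (rule local_int_cone[OF assms _ has_vector_derivative_cis_double])
    (simp only: cis_double_periodic)

lemma local_int_outside: "closed X \<Longrightarrow> v \<notin> X \<Longrightarrow> local_int h X v = 0"
  unfolding local_int_def by (simp add: off_not_near off_ray_outside)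

section \<open>Local cones of convex sets\<close>

lemma near_ray_open:
  assumes "open U" "v \<in> U"
  shows "near_ray U v \<theta>"
proof -
  have "((\<lambda>r. v + of_real r * cis \<theta>) \<longlongrightarrow> v + of_real 0 * cis \<theta>) (at_right 0)"
    by (intro tendsto_intros)
  then show ?thesis unfolding near_ray_def
    using assms by (intro topological_tendstoD) auto
qed

lemma cone_at_interior: "v \<in> interior X \<Longrightarrow> cone_at X v 0 (2 * pi)"
  unfolding cone_at_def by (auto intro: near_ray_open)

text \<open>The imaginary part is the cross product of the two difference vectors, twice the signed
  area; its sign later serves as the orientation.\<close>

lemma collinear_complex_iff:
  "collinear {a, b, c :: complex} \<longleftrightarrow> Im (cnj (b - a) * (c - a)) = 0"
proof -
  have "collinear {a, b, c} \<longleftrightarrow> collinear {0, b - a, c - a}"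
    using collinear_3[of b a c] by (simp add: insert_commute)
  also have "\<dots> \<longleftrightarrow> Im (cnj (b - a) * (c - a)) = 0"
  proof (cases "b = a")
    case True
    then show ?thesis by (simp add: collinear_lemma)
  next
    case False
    have "(\<exists>k. c - a = k *\<^sub>R (b - a)) \<longleftrightarrow> Im (cnj (b - a) * (c - a)) = 0"
    proof
      assume "\<exists>k. c - a = k *\<^sub>R (b - a)"
      then obtain k where k: "c - a = k *\<^sub>R (b - a)" by blast
      show "Im (cnj (b - a) * (c - a)) = 0" unfolding k by (simp add: algebra_simps)
    next
      assume *: "Im (cnj (b - a) * (c - a)) = 0"
      define k where "k = Re (cnj (b - a) * (c - a)) / (cmod (b - a))\<^sup>2"
      have "cnj (b - a) * (c - a) = of_real (k * (cmod (b - a))\<^sup>2)"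
        using * False by (simp add: complex_eq_iff k_def)
      also have "\<dots> = cnj (b - a) * (of_real k * (b - a))"
        by (simp only: of_real_mult complex_norm_square) simp
      finally have "c - a = of_real k * (b - a)"
        using False by simp
      then show "\<exists>k. c - a = k *\<^sub>R (b - a)"
        by (auto simp: scaleR_conv_of_real)
    qed
    then show ?thesis using False
      by (auto simp: collinear_lemma)
  qed
  finally show ?thesis .
qed

lemma near_ray_triangle:
  assumes "convex X" and mem: "v \<in> X" "v + of_real \<rho> * cis \<phi> \<in> X" "v + of_real \<sigma> * cis (\<phi> + A) \<in> X"
    and pos: "\<rho> > 0" "\<sigma> > 0" and A: "A < pi" and \<theta>: "\<phi> < \<theta>" "\<theta> < \<phi> + A"
  shows "near_ray (interior X) v \<theta>"
proof -
  let ?p = "v + of_real \<rho> * cis \<phi>" and ?q = "v + of_real \<sigma> * cis (\<phi> + A)"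
  have sA: "sin A > 0" using A \<theta> by (intro sin_gt_zero) auto
  have "Im (cnj (?p - v) * (?q - v)) = \<rho> * \<sigma> * sin A"
  proof -
    have "cnj (?p - v) * (?q - v) = of_real (\<rho> * \<sigma>) * (cis (- \<phi>) * cis (\<phi> + A))"
      by (simp add: cis_cnj mult_ac)
    also have "cis (- \<phi>) * cis (\<phi> + A) = cis A" by (simp add: cis_mult)
    finally have *: "cnj (?p - v) * (?q - v) = of_real (\<rho> * \<sigma>) * cis A" .
    show ?thesis unfolding * by simp
  qed
  then have nc: "\<not> collinear {v, ?p, ?q}"
    using sA pos by (simp add: collinear_complex_iff)
  \<comment> \<open>By Cramer's rule \<open>cis \<theta>\<close> has coefficients
    \<open>sin (\<phi> + A - \<theta>) / sin A\<close> and
    \<open>sin (\<theta> - \<phi>) / sin A\<close> in the basis of the two bounding directions. For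
    small \<open>r\<close> they give positive barycentric coordinates in the triangle.\<close>
  define x where "x = sin (\<phi> + A - \<theta>) / (\<rho> * sin A)"
  define y where "y = sin (\<theta> - \<phi>) / (\<sigma> * sin A)"
  have "sin (\<phi> + A - \<theta>) > 0" "sin (\<theta> - \<phi>) > 0"
    using A \<theta> by (auto intro!: sin_gt_zero)
  then have xy: "x > 0" "y > 0" using sA pos by (auto simp: x_def y_def)
  have "of_real (sin A) * cis \<theta> = of_real (sin (\<phi> + A - \<theta>)) * cis \<phi> + of_real (sin (\<theta> - \<phi>)) * cis (\<phi> + A)"
  proof -
    define s where "s = \<theta> - \<phi>"
    have \<theta>s: "\<theta> = \<phi> + s" by (simp add: s_def)
    have "of_real (sin A) * cis s = of_real (sin (A - s)) + of_real (sin s) * cis A"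
      by (simp add: complex_eq_iff sin_diff algebra_simps)
    then have "cis \<phi> * (of_real (sin A) * cis s) = cis \<phi> * (of_real (sin (A - s)) + of_real (sin s) * cis A)"
      by simp
    then show ?thesis unfolding \<theta>s cis_mult[symmetric] by (simp add: algebra_simps)
  qed
  then have ray: "cis \<theta> = of_real (x * \<rho>) * cis \<phi> + of_real (y * \<sigma>) * cis (\<phi> + A)"
    using sA pos by (simp add: x_def y_def field_simps)
  have "\<forall>\<^sub>F r in at_right 0. v + of_real r * cis \<theta> \<in> interior X"
    unfolding eventually_at_right_field
  proof (intro exI conjI allI impI)
    show "0 < 1 / (x + y)" using xy by simp
    fix r :: real assume r: "0 < r" "r < 1 / (x + y)"
    then have "r * x + r * y < 1" using xy by (simp add: field_simps)
    moreover have "(1 - r * x - r * y) *\<^sub>R v + (r * x) *\<^sub>R ?p + (r * y) *\<^sub>R ?q = v + of_real r * cis \<theta>"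
      unfolding ray by (simp add: scaleR_conv_of_real algebra_simps)
    ultimately have "v + of_real r * cis \<theta> \<in> interior (convex hull {v, ?p, ?q})"
      unfolding interior_convex_hull_3_minimal[OF nc DIM_complex] using r xy
      by (intro CollectI exI[of _ "1 - r * x - r * y"] exI[of _ "r * x"] exI[of _ "r * y"]) simp
    moreover have "convex hull {v, ?p, ?q} \<subseteq> X"
      using mem \<open>convex X\<close> by (intro hull_minimal) auto
    ultimately show "v + of_real r * cis \<theta> \<in> interior X"
      using interior_mono by blast
  qed
  then show ?thesis unfolding near_ray_def .
qed

lemma off_ray_I: "(\<And>r. r > 0 \<Longrightarrow> v + of_real r * cis \<theta> \<notin> X) \<Longrightarrow> off_ray X v \<theta>"
  unfolding off_ray_def eventually_at_right_field by (intro exI[of _ 1]) auto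

lemma Im_ray: "Im ((v + of_real r * cis \<theta> - v) * cis (- \<phi>)) = r * sin (\<theta> - \<phi>)"
  by (simp add: sin_diff algebra_simps)

text \<open>A direction beyond the sector violates the second half-plane as long as
  \<open>\<theta> - \<phi> \<le> pi\<close>, and the first one afterwards.\<close>

lemma cone_at_corner:
  assumes "convex X" "v \<in> X" "v + of_real \<rho> * cis \<phi> \<in> X" "v + of_real \<sigma> * cis (\<phi> + A) \<in> X"
    and "\<rho> > 0" "\<sigma> > 0" and A: "0 < A" "A < pi"
    and half1: "\<And>x. x \<in> X \<Longrightarrow> Im ((x - v) * cis (- \<phi>)) \<ge> 0"
    and half2: "\<And>x. x \<in> X \<Longrightarrow> Im ((x - v) * cis (- (\<phi> + A))) \<le> 0"
  shows "cone_at X v \<phi> A"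
  unfolding cone_at_def
proof (intro conjI allI impI)
  fix \<theta> assume "\<phi> < \<theta> \<and> \<theta> < \<phi> + A"
  then show "near_ray (interior X) v \<theta>"
    using assms by (intro near_ray_triangle[of X v \<rho> \<phi> \<sigma> A]) auto
next
  fix \<theta> assume \<theta>: "\<phi> + A < \<theta> \<and> \<theta> < \<phi> + 2 * pi"
  show "off_ray X v \<theta>"
  proof (rule off_ray_I, rule notI)
    fix r :: real assume r: "r > 0" "v + of_real r * cis \<theta> \<in> X"
    have "r * sin (\<theta> - \<phi>) \<ge> 0" using half1[OF r(2)] unfolding Im_ray .
    then have 1: "sin (\<theta> - \<phi>) \<ge> 0" using r by (simp add: zero_le_mult_iff)
    have "r * sin (\<theta> - (\<phi> + A)) \<le> 0" using half2[OF r(2)] unfolding Im_ray .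
    then have 2: "sin (\<theta> - (\<phi> + A)) \<le> 0" using r by (simp add: mult_le_0_iff)
    show False
    proof (cases "\<theta> - \<phi> \<le> pi")
      case True
      then have "sin (\<theta> - (\<phi> + A)) > 0" using \<theta> A by (intro sin_gt_zero) auto
      then show False using 2 by simp
    next
      case False
      then have "sin (\<theta> - \<phi>) < 0" using \<theta> A by (intro sin_lt_zero) auto
      then show False using 1 by simp
    qed
  qed
qed (use A in auto)

lemma Im_pos_polar:
  assumes "Im u > 0"
  obtains \<rho> B where "\<rho> > 0" "0 < B" "B < pi" "u = of_real \<rho> * cis B"
proof
  show "cmod u > 0" using assms by auto
  show "0 < Arg u" "Arg u < pi" using assms Arg_lt_pi[of u] by auto
  show "u = of_real (cmod u) * cis (Arg u)"
    by (metis rcis_cmod_Arg rcis_def)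
qed

text \<open>A straight angle is too wide for \<open>near_ray_triangle\<close>, so the direction of
  an interior point \<open>z\<close> splits it into two angles below \<open>pi\<close>.\<close>

lemma cone_at_side_aux:
  assumes X: "convex X" "v \<in> X" and z: "z \<in> interior X"
    and pq: "v + of_real s * cis \<phi> \<in> X" "v + of_real t * cis (\<phi> + pi) \<in> X" "s > 0" "t > 0"
    and half: "\<And>x. x \<in> X \<Longrightarrow> Im ((x - v) * cis (- \<phi>)) \<ge> 0"
    and zpos: "Im ((z - v) * cis (- \<phi>)) > 0"
  shows "cone_at X v \<phi> pi"
  unfolding cone_at_def
proof (intro conjI allI impI)
  obtain \<rho> B where B: "\<rho> > 0" "0 < B" "B < pi" "(z - v) * cis (- \<phi>) = of_real \<rho> * cis B"
    using Im_pos_polar[OF zpos] by blast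
  have "(z - v) * cis (- \<phi>) * cis \<phi> = of_real \<rho> * cis (\<phi> + B)"
    unfolding B(4) by (simp add: cis_mult add.commute)
  then have zv: "z = v + of_real \<rho> * cis (\<phi> + B)" by (simp add: mult.assoc cis_mult algebra_simps)
  have zX: "v + of_real \<rho> * cis (\<phi> + B) \<in> X" using z zv interior_subset by blast
  fix \<theta> assume \<theta>: "\<phi> < \<theta> \<and> \<theta> < \<phi> + pi"
  consider "\<theta> < \<phi> + B" | "\<theta> = \<phi> + B" | "\<theta> > \<phi> + B" by linarith
  then show "near_ray (interior X) v \<theta>"
  proof cases
    case 1
    then show ?thesis using X pq zX B \<theta>
      by (intro near_ray_triangle[of X v s \<phi> \<rho> B]) auto
  next
    case 2
    have "v + of_real r * cis \<theta> \<in> interior X" if "0 < r" "r < \<rho>" for r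
    proof -
      have "v - (r / \<rho>) *\<^sub>R (v - z) \<in> interior X"
        using that X z by (intro mem_interior_convex_shrink) auto
      then show ?thesis using B(1) 2 unfolding zv by (simp add: scaleR_conv_of_real)
    qed
    then show ?thesis unfolding near_ray_def eventually_at_right_field using B(1) by blast
  next
    case 3
    then show ?thesis using X pq zX B \<theta>
      by (intro near_ray_triangle[of X v \<rho> "\<phi> + B" t "pi - B"]) (auto simp: algebra_simps)
  qed
next
  fix \<theta> assume \<theta>: "\<phi> + pi < \<theta> \<and> \<theta> < \<phi> + 2 * pi"
  show "off_ray X v \<theta>"
  proof (rule off_ray_I, rule notI)
    fix r :: real assume r: "r > 0" "v + of_real r * cis \<theta> \<in> X"
    have "r * sin (\<theta> - \<phi>) \<ge> 0" using half[OF r(2)] unfolding Im_ray .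
    moreover have "sin (\<theta> - \<phi>) < 0" using \<theta> by (intro sin_lt_zero) auto
    ultimately show False using r(1) by (simp add: zero_le_mult_iff)
  qed
qed (use pi_gt_zero in auto)

text \<open>A boundary point inside an open segment of \<open>X\<close> has a supporting line. The
  distances of the end points from it are nonnegative with a vanishing weighted sum, so both ends
  lie on the line, on opposite sides of \<open>v\<close>, and the cone is a half-plane.\<close>

lemma cone_at_nonextreme:
  assumes X: "convex X" "closed X" "interior X \<noteq> {}" and v: "v \<in> X" "\<not> v extreme_point_of X"
  obtains \<phi> A where "cone_at X v \<phi> A" "A = pi \<or> A = 2 * pi"
proof (cases "v \<in> interior X")
  case True
  then show ?thesis using cone_at_interior that by blast
next
  case False
  obtain p q where pq: "p \<in> X" "q \<in> X" "v \<in> open_segment p q"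
    using v unfolding extreme_point_of_def by blast
  obtain a where a: "a \<noteq> 0" "\<And>x. x \<in> X \<Longrightarrow> a \<bullet> v \<le> a \<bullet> x"
      "\<And>x. x \<in> rel_interior X \<Longrightarrow> a \<bullet> v < a \<bullet> x"
  proof -
    have "v \<notin> rel_interior X" using False X rel_interior_nonempty_interior by blast
    then show ?thesis
      using supporting_hyperplane_rel_boundary[OF X(1) v(1)] that by blast
  qed
  obtain z where z: "z \<in> interior X" using X by blast
  \<comment> \<open>The inner normal \<open>a\<close> is turned clockwise by a right angle, so that
    \<phi> runs along the supporting line with \<open>X\<close> on its left.\<close>
  define \<phi> where "\<phi> = Arg a - pi / 2"
  have Im_inner: "cmod a * Im ((x - v) * cis (- \<phi>)) = a \<bullet> x - a \<bullet> v" for x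
  proof -
    have a: "a = of_real (cmod a) * cis (Arg a)" by (metis rcis_cmod_Arg rcis_def)
    have "a \<bullet> (x - v) = cmod a * (cos (Arg a) * Re (x - v) + sin (Arg a) * Im (x - v))"
      by (subst (1) a) (simp add: inner_complex_def algebra_simps)
    then show ?thesis
      by (simp add: \<phi>_def cos_diff sin_diff inner_diff_right algebra_simps)
  qed
  have half: "Im ((x - v) * cis (- \<phi>)) \<ge> 0" if "x \<in> X" for x
  proof -
    have "cmod a * Im ((x - v) * cis (- \<phi>)) \<ge> 0" using Im_inner[of x] a(2)[OF that] by simp
    then show ?thesis using a(1) by (simp add: zero_le_mult_iff)
  qed
  have zpos: "Im ((z - v) * cis (- \<phi>)) > 0"
  proof -
    have "z \<in> rel_interior X" using z interior_subset_rel_interior by blast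
    then have "cmod a * Im ((z - v) * cis (- \<phi>)) > 0" using Im_inner[of z] a(3) by simp
    then show ?thesis by (simp add: zero_less_mult_iff)
  qed
  obtain u where u: "0 < u" "u < 1" "v = (1 - u) *\<^sub>R p + u *\<^sub>R q" "p \<noteq> q"
    using pq(3) by (auto simp: in_segment)
  have vv: "(1 - u) *\<^sub>R (p - v) + u *\<^sub>R (q - v) = 0"
    unfolding scaleR_diff_right using u(3) by (simp add: algebra_simps)
  define P where "P = (p - v) * cis (- \<phi>)"
  define Q where "Q = (q - v) * cis (- \<phi>)"
  have PQ: "(1 - u) *\<^sub>R P + u *\<^sub>R Q = 0"
    unfolding P_def Q_def using arg_cong[OF vv, of "\<lambda>x. x * cis (- \<phi>)"] by (simp add: distrib_right)
  have ImPQ: "Im P \<ge> 0" "Im Q \<ge> 0" using half pq unfolding P_def Q_def by auto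
  have "(1 - u) * Im P + u * Im Q = 0" using arg_cong[OF PQ, of Im] by simp
  then have Im0: "Im P = 0" "Im Q = 0"
    using ImPQ u by (simp_all add: add_nonneg_eq_0_iff)
  have Re0: "(1 - u) * Re P + u * Re Q = 0" using arg_cong[OF PQ, of Re] by simp
  have polar: "x = v + of_real t * cis \<phi>" if "(x - v) * cis (- \<phi>) = of_real t" for x t
  proof -
    have "(x - v) * cis (- \<phi>) * cis \<phi> = of_real t * cis \<phi>" using that by simp
    then show ?thesis by (simp add: mult.assoc cis_mult algebra_simps)
  qed
  have p: "p = v + of_real (Re P) * cis \<phi>" using Im0 by (intro polar) (simp add: P_def complex_eq_iff)
  have q: "q = v + of_real (Re Q) * cis \<phi>" using Im0 by (intro polar) (simp add: Q_def complex_eq_iff)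
  have neg: "v + of_real t * cis \<phi> = v + of_real (- t) * cis (\<phi> + pi)" for t
    by (simp add: complex_eq_iff)
  have "Re P \<noteq> 0"
  proof
    assume "Re P = 0"
    then have "Re Q = 0" using Re0 u by simp
    have "p = v" by (subst p) (simp add: \<open>Re P = 0\<close>)
    moreover have "q = v" by (subst q) (simp add: \<open>Re Q = 0\<close>)
    ultimately show False using u(4) by simp
  qed
  then have "Re P * Re Q < 0"
  proof -
    have "u * (Re P * Re Q) = - ((1 - u) * (Re P)\<^sup>2)"
      using Re0 by (simp add: power2_eq_square algebra_simps) algebra
    then have "u * (Re P * Re Q) < 0" using u \<open>Re P \<noteq> 0\<close> by simp
    then show ?thesis using u(1) by (simp add: mult_less_0_iff)
  qed
  then consider "Re P > 0" "Re Q < 0" | "Re P < 0" "Re Q > 0"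
    by (auto simp: mult_less_0_iff)
  moreover have "v + of_real (Re P) * cis \<phi> \<in> X" "v + of_real (Re Q) * cis \<phi> \<in> X"
    "v + of_real (- Re P) * cis (\<phi> + pi) \<in> X" "v + of_real (- Re Q) * cis (\<phi> + pi) \<in> X"
    unfolding neg[symmetric] p[symmetric] q[symmetric] by (fact pq)+
  ultimately have "cone_at X v \<phi> pi"
  proof cases
    case 1
    show ?thesis
      by (rule cone_at_side_aux[OF X(1) v(1) z \<open>v + of_real (Re P) * cis \<phi> \<in> X\<close>
            \<open>v + of_real (- Re Q) * cis (\<phi> + pi) \<in> X\<close> _ _ half zpos]) (use 1 in auto)
  next
    case 2
    show ?thesis
      by (rule cone_at_side_aux[OF X(1) v(1) z \<open>v + of_real (Re Q) * cis \<phi> \<in> X\<close>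
            \<open>v + of_real (- Re P) * cis (\<phi> + pi) \<in> X\<close> _ _ half zpos]) (use 2 in auto)
  qed
  then show ?thesis using that by blast
qed

lemma twist_flat:
  assumes "A = pi \<or> A = 2 * pi" "cone_at X v \<phi> A"
  shows "local_twist X v = 0"
  using assms(1) unfolding local_twist_cone[OF assms(2)]
  by (elim disjE; simp only: cis_double_periodic cis_double_periodic_pi diff_self)

section \<open>Triangles\<close>

text \<open>For nonzero \<open>d\<close> this is \<open>cis (- 2 * Arg d)\<close>. It depends only
  on the line spanned by \<open>d\<close>, so it encodes an unoriented edge direction, and it is the
  factor that turns \<open>d\<close> into \<open>cnj d\<close>.\<close>

definition kap :: "complex \<Rightarrow> complex" where "kap d = cnj d / d"

lemma kap_uminus: "kap (- d) = kap d"
  by (simp add: kap_def)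

lemma kap_minus_commute: "kap (x - y) = kap (y - x)"
  using kap_uminus[of "x - y"] by simp

lemma kap_polar:
  assumes "\<rho> > 0"
  shows "kap (of_real \<rho> * cis \<phi>) = cis (- 2 * \<phi>)"
proof -
  have "kap (of_real \<rho> * cis \<phi>) = cis (- \<phi>) / cis \<phi>"
    using assms by (simp add: kap_def cis_cnj)
  then show ?thesis by (simp add: cis_divide)
qed

lemma convex_hull_left_halfplane:
  assumes "\<And>x. x \<in> V \<Longrightarrow> Im (cnj d * (x - a)) \<ge> 0" "x \<in> convex hull V"
  shows "Im (cnj d * (x - a)) \<ge> 0"
proof -
  have eq: "{x. Im (cnj d * (x - a)) \<ge> 0} = {x. (\<i> * d) \<bullet> x \<ge> (\<i> * d) \<bullet> a}"
    by (auto simp: inner_complex_def algebra_simps)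
  have "convex hull V \<subseteq> {x. Im (cnj d * (x - a)) \<ge> 0}"
    unfolding eq using assms(1) by (intro hull_minimal convex_halfspace_ge) (auto simp: eq[symmetric])
  then show ?thesis using assms(2) by blast
qed

lemma Im_cnj_polar: "Im (cnj (of_real r * cis \<phi>) * y) = r * Im (y * cis (- \<phi>))"
  by (simp add: algebra_simps)

lemma corner_cone:
  assumes X: "convex X" "a \<in> X" "b \<in> X" "c \<in> X"
    and u: "cnj (b - a) * (c - a) = of_real r * cis A" "r > 0" and A: "0 < A" "A < pi"
    and half1: "\<And>x. x \<in> X \<Longrightarrow> Im (cnj (b - a) * (x - a)) \<ge> 0"
    and half2: "\<And>x. x \<in> X \<Longrightarrow> Im (cnj (c - a) * (x - a)) \<le> 0"
  obtains \<phi> where "cone_at X a \<phi> A" "kap (b - a) = cis (- 2 * \<phi>)" "kap (c - a) = cis (- 2 * (\<phi> + A))"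
proof -
  have ba: "b \<noteq> a" using u by auto
  define \<rho> where "\<rho> = cmod (b - a)"
  define \<phi> where "\<phi> = Arg (b - a)"
  define \<sigma> where "\<sigma> = r / \<rho>"
  have pos: "\<rho> > 0" "\<sigma> > 0" using ba u by (auto simp: \<rho>_def \<sigma>_def)
  have b: "b - a = of_real \<rho> * cis \<phi>" unfolding \<rho>_def \<phi>_def by (metis rcis_cmod_Arg rcis_def)
  have c: "c - a = of_real \<sigma> * cis (\<phi> + A)"
  proof -
    have "of_real \<rho> * cis (- \<phi>) * (c - a) = of_real r * cis A"
      using u(1) unfolding b by (simp add: cis_cnj)
    then have "cis \<phi> * (of_real \<rho> * cis (- \<phi>) * (c - a)) = cis \<phi> * (of_real r * cis A)" by simp
    moreover have "cis \<phi> * (of_real \<rho> * cis (- \<phi>) * (c - a)) = of_real \<rho> * (c - a) * (cis \<phi> * cis (- \<phi>))"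
      by simp
    moreover have "cis \<phi> * cis (- \<phi>) = 1" by (simp add: cis_mult)
    ultimately have "of_real \<rho> * (c - a) = of_real r * cis (\<phi> + A)"
      by (simp add: cis_mult[symmetric])
    then show ?thesis using pos by (simp add: \<sigma>_def field_simps)
  qed
  have "cone_at X a \<phi> A"
  proof (rule cone_at_corner[where \<rho> = \<rho> and \<sigma> = \<sigma>])
    show "a + of_real \<rho> * cis \<phi> \<in> X" "a + of_real \<sigma> * cis (\<phi> + A) \<in> X"
      using X unfolding b[symmetric] c[symmetric] by simp_all
    fix x assume x: "x \<in> X"
    have "\<rho> * Im ((x - a) * cis (- \<phi>)) = Im (cnj (b - a) * (x - a))"
      unfolding b Im_cnj_polar ..
    then show "Im ((x - a) * cis (- \<phi>)) \<ge> 0" using half1[OF x] pos by (metis zero_le_mult_iff not_less)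
    have "\<sigma> * Im ((x - a) * cis (- (\<phi> + A))) = Im (cnj (c - a) * (x - a))"
      unfolding c Im_cnj_polar ..
    then show "Im ((x - a) * cis (- (\<phi> + A))) \<le> 0" using half2[OF x] pos by (metis mult_le_0_iff not_less)
  qed (use X A pos in auto)
  moreover have "kap (b - a) = cis (- 2 * \<phi>)" "kap (c - a) = cis (- 2 * (\<phi> + A))"
    unfolding b c using pos by (simp_all only: kap_polar)
  ultimately show ?thesis using that by blast
qed

lemma corner_values:
  assumes "convex X" "a \<in> X" "b \<in> X" "c \<in> X"
    and "cnj (b - a) * (c - a) = of_real r * cis A" "r > 0" and "0 < A" "A < pi"
    and "\<And>x. x \<in> X \<Longrightarrow> Im (cnj (b - a) * (x - a)) \<ge> 0"
    and "\<And>x. x \<in> X \<Longrightarrow> Im (cnj (c - a) * (x - a)) \<le> 0"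
  shows "\<exists>\<phi> A. cone_at X a \<phi> A" "local_angle X a = of_real A"
    and "local_twist X a = kap (c - a) - kap (b - a)"
proof -
  obtain \<phi> where "cone_at X a \<phi> A" "kap (b - a) = cis (- 2 * \<phi>)" "kap (c - a) = cis (- 2 * (\<phi> + A))"
    using corner_cone[OF assms] by metis
  then show "\<exists>\<phi> A. cone_at X a \<phi> A" "local_angle X a = of_real A"
    "local_twist X a = kap (c - a) - kap (b - a)"
    using local_angle_cone local_twist_cone by auto
qed

lemma angle_at_commute: "angle_at b a c = angle_at c a b"
  by (simp add: angle_at_def inner_commute mult.commute)

text \<open>The vertices of a tile are named by their angles, so both orientations occur; this sign
  carries the orientation into the twist.\<close>

definition orient :: "complex \<Rightarrow> complex \<Rightarrow> complex \<Rightarrow> real" where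
  "orient a b c = sgn (Im (cnj (b - a) * (c - a)))"

lemma orient_cyclic: "orient b c a = orient a b c"
  unfolding orient_def by (rule arg_cong[of _ _ sgn]) (simp add: algebra_simps)

lemma orient_swap: "orient a c b = - orient a b c"
proof -
  have "Im (cnj (c - a) * (b - a)) = - Im (cnj (b - a) * (c - a))" by (simp add: algebra_simps)
  then show ?thesis unfolding orient_def by (simp only: sgn_minus)
qed

lemma triangle_vertex_pos:
  assumes pos: "Im (cnj (b - a) * (c - a)) > 0"
  defines "X \<equiv> convex hull {a, b, c}"
  shows "\<exists>\<phi> A. cone_at X a \<phi> A" "local_angle X a = of_real (angle_at b a c)"
    and "local_twist X a = kap (c - a) - kap (b - a)"
proof -
  obtain r A where rA: "r > 0" "0 < A" "A < pi" "cnj (b - a) * (c - a) = of_real r * cis A"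
    using Im_pos_polar[OF pos] by blast
  have mem: "a \<in> X" "b \<in> X" "c \<in> X" unfolding X_def by (simp_all add: hull_inc)
  have half1: "Im (cnj (b - a) * (x - a)) \<ge> 0" if "x \<in> X" for x
  proof (rule convex_hull_left_halfplane[OF _ that[unfolded X_def]])
    fix y assume "y \<in> {a, b, c}"
    then show "Im (cnj (b - a) * (y - a)) \<ge> 0" using pos by (auto simp: algebra_simps)
  qed
  have half2: "Im (cnj (c - a) * (x - a)) \<le> 0" if "x \<in> X" for x
  proof -
    have "Im (cnj (- (c - a)) * (x - a)) \<ge> 0"
    proof (rule convex_hull_left_halfplane[OF _ that[unfolded X_def]])
      fix y assume "y \<in> {a, b, c}"
      then show "Im (cnj (- (c - a)) * (y - a)) \<ge> 0" using pos by (auto simp: algebra_simps)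
    qed
    then show ?thesis by (simp only: complex_cnj_minus mult_minus_left uminus_complex.sel neg_0_le_iff_le)
  qed
  have "angle_at b a c = A"
  proof -
    have "(b - a) \<bullet> (c - a) = Re (cnj (b - a) * (c - a))" by (simp add: inner_complex_def algebra_simps)
    also have "\<dots> = r * cos A" unfolding rA(4) by simp
    finally have i: "(b - a) \<bullet> (c - a) = r * cos A" .
    have "cmod (b - a) * cmod (c - a) = cmod (cnj (b - a) * (c - a))" by (simp only: norm_mult complex_mod_cnj)
    also have "\<dots> = r" unfolding rA(4) using rA(1) by (simp add: norm_mult)
    finally show ?thesis
      unfolding angle_at_def i using rA by (simp add: arccos_cos)
  qed
  then show "\<exists>\<phi> A. cone_at X a \<phi> A" "local_angle X a = of_real (angle_at b a c)"
    "local_twist X a = kap (c - a) - kap (b - a)"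
    using corner_values[OF _ mem rA(4,1,2,3) half1 half2] by (simp_all add: X_def)
qed

lemma triangle_vertex:
  assumes "\<not> collinear {a, b, c}"
  defines "X \<equiv> convex hull {a, b, c}"
  shows "\<exists>\<phi> A. cone_at X a \<phi> A" "local_angle X a = of_real (angle_at b a c)"
    and "local_twist X a = of_real (orient a b c) * (kap (c - a) - kap (b - a))"
proof -
  consider "Im (cnj (b - a) * (c - a)) > 0" | "Im (cnj (b - a) * (c - a)) < 0"
    using assms(1) unfolding collinear_complex_iff by linarith
  then have "(\<exists>\<phi> A. cone_at X a \<phi> A) \<and> local_angle X a = of_real (angle_at b a c) \<and>
    local_twist X a = of_real (orient a b c) * (kap (c - a) - kap (b - a))"
  proof cases
    case 1
    then have "orient a b c = 1" by (simp add: orient_def)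
    then show ?thesis using triangle_vertex_pos[OF 1] unfolding X_def by auto
  next
    case 2
    then have o: "orient a b c = - 1" by (simp add: orient_def)
    have "Im (cnj (c - a) * (b - a)) > 0" using 2 by (simp add: algebra_simps)
    from triangle_vertex_pos[OF this] show ?thesis
      unfolding X_def o angle_at_commute[of b a c] by (simp add: insert_commute)
  qed
  then show "\<exists>\<phi> A. cone_at X a \<phi> A" "local_angle X a = of_real (angle_at b a c)"
    "local_twist X a = of_real (orient a b c) * (kap (c - a) - kap (b - a))"
    by blast+
qed

lemma triangle_interior:
  assumes "\<not> collinear {a, b, c :: complex}"
  shows "interior (convex hull {a, b, c}) \<noteq> {}"
proof -
  have "(1/3) *\<^sub>R a + (1/3) *\<^sub>R b + (1/3) *\<^sub>R c \<in> interior (convex hull {a, b, c})"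
    unfolding interior_convex_hull_3_minimal[OF assms DIM_complex]
    by (intro CollectI exI[of _ "1/3"]) simp
  then show ?thesis by blast
qed

lemma hull_nonvertex:
  assumes V: "finite V" and int: "interior (convex hull V) \<noteq> {}"
    and v: "v \<in> convex hull V" "v \<notin> V"
  obtains \<phi> A where "cone_at (convex hull V) v \<phi> A" "A = pi \<or> A = 2 * pi"
    "local_angle (convex hull V) v = of_real A" "local_twist (convex hull V) v = 0"
proof -
  have "\<not> v extreme_point_of (convex hull V)"
    using v extreme_point_of_convex_hull by blast
  then obtain \<phi> A where "cone_at (convex hull V) v \<phi> A" "A = pi \<or> A = 2 * pi"
    using cone_at_nonextreme[of "convex hull V" v] int v(1) V
    by (metis convex_convex_hull compact_imp_closed finite_imp_compact_convex_hull)
  then show ?thesis using that local_angle_cone twist_flat by blast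
qed

section \<open>Regular polygons\<close>

text \<open>Integer indices give every vertex its two neighbours \<open>k - 1\<close> and
  \<open>k + 1\<close> without reduction modulo \<open>n\<close>.\<close>

definition ngon_vertex :: "nat \<Rightarrow> complex \<Rightarrow> complex \<Rightarrow> int \<Rightarrow> complex" where
  "ngon_vertex n z w k = z + w * cis (2 * pi / real n * of_int k)"

lemma range_ngon_vertex:
  assumes "n > 0"
  shows "range (ngon_vertex n z w) = (\<lambda>k. z + w * cis (2 * pi * real k / real n)) ` {..<n}"
proof (intro equalityI subsetI)
  fix x assume "x \<in> range (ngon_vertex n z w)"
  then obtain k where k: "x = ngon_vertex n z w k" by blast
  define r where "r = nat (k mod int n)"
  have r: "r < n" "int r = k mod int n" using assms by (auto simp: r_def nat_less_iff)
  have "k = int r + int n * (k div int n)" using r by simp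
  then have "real_of_int k = real r + real n * of_int (k div int n)"
    by (metis of_int_add of_int_mult of_int_of_nat_eq)
  then have "2 * pi / real n * of_int k = 2 * pi * real r / real n + 2 * pi * of_int (k div int n)"
    using assms by (simp add: field_simps)
  moreover have "cis (2 * pi * of_int (k div int n)) = 1" by (rule cis_multiple_2pi) simp
  ultimately have "cis (2 * pi / real n * of_int k) = cis (2 * pi * real r / real n)"
    by (metis cis_mult mult.right_neutral)
  then show "x \<in> (\<lambda>k. z + w * cis (2 * pi * real k / real n)) ` {..<n}"
    using r k by (auto simp: ngon_vertex_def)
next
  fix x assume "x \<in> (\<lambda>k. z + w * cis (2 * pi * real k / real n)) ` {..<n}"
  then obtain k where "x = ngon_vertex n z w (int k)" by (auto simp: ngon_vertex_def)
  then show "x \<in> range (ngon_vertex n z w)" by blast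
qed

text \<open>Up to a positive factor this is the cross product of a side with the vector to the
  vertex \<open>m\<close> steps on. With \<open>s = pi / n\<close> it equals
  \<open>4 * sin (m * s) * sin ((m - 1) * s) * sin s\<close>, and the two consecutive multiples of
  \<open>s\<close> lie in the same half period. Only for \<open>m = - n\<close> does
  \<open>(m - 1) * s\<close> leave it, hence the separate case.\<close>

lemma ngon_halfplane_aux:
  assumes "n > 0" "- int n \<le> m" "m \<le> int n"
  defines "\<theta> \<equiv> 2 * pi / real n"
  shows "sin (\<theta> * of_int m - \<theta>) - sin (\<theta> * of_int m) + sin \<theta> \<ge> 0"
proof (cases "m = - int n")
  case True
  then have "\<theta> * of_int m = - 2 * pi" using assms by simp
  then show ?thesis by (simp add: sin_diff)
next
  case False
  define s where "s = pi / real n"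
  have \<theta>: "\<theta> = 2 * s" by (simp add: \<theta>_def s_def)
  have ns: "real n * s = pi" and s: "s > 0" using assms(1) by (simp_all add: s_def)
  have eq: "sin (\<theta> * of_int m - \<theta>) - sin (\<theta> * of_int m) + sin \<theta> = 4 * (sin (of_int m * s) * sin ((of_int m - 1) * s)) * sin s"
  proof -
    define t where "t = of_int m * s"
    have *: "\<theta> * of_int m - \<theta> = 2 * (t - s)" "\<theta> * of_int m = 2 * t" "(of_int m - 1) * s = t - s"
      by (simp_all add: \<theta> t_def algebra_simps)
    show ?thesis
      unfolding * unfolding \<theta> t_def[symmetric] sin_double cos_double_sin sin_diff by algebra
  qed
  have "s \<le> pi" unfolding s_def using assms(1) by (simp add: field_simps)
  then have sp: "sin s \<ge> 0" using s by (intro sin_ge_zero) auto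
  have "sin (of_int m * s) * sin ((of_int m - 1) * s) \<ge> 0"
  proof (cases "m \<ge> 1")
    case True
    have "of_int m * s \<le> real n * s" using assms(3) s by (intro mult_right_mono) auto
    moreover have "(of_int m - 1) * s \<le> of_int m * s" using s by simp
    moreover have "0 \<le> (of_int m - 1) * s" using True s by simp
    ultimately have "sin (of_int m * s) \<ge> 0" "sin ((of_int m - 1) * s) \<ge> 0"
      unfolding ns by (intro sin_ge_zero; linarith)+
    then show ?thesis by simp
  next
    case c: False
    have "- real n * s \<le> (of_int m - 1) * s" using False assms(2) s by (intro mult_right_mono) auto
    moreover have "(of_int m - 1) * s \<le> of_int m * s" using s by simp
    moreover have "of_int m * s \<le> 0" using c s by (simp add: mult_le_0_iff)
    ultimately have "sin (- (of_int m * s)) \<ge> 0" "sin (- ((of_int m - 1) * s)) \<ge> 0"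
      using ns by (intro sin_ge_zero; linarith)+
    then show ?thesis by (simp add: mult_nonpos_nonpos)
  qed
  then show ?thesis unfolding eq using sp by simp
qed

lemma ngon_corner:
  fixes z w :: complex
  assumes n: "n \<ge> 3" and w: "w \<noteq> 0"
  defines "v \<equiv> ngon_vertex n z w"
  defines "X \<equiv> convex hull (range v)"
  shows "\<exists>\<phi> A. cone_at X (v k) \<phi> A" "local_angle X (v k) = of_real (pi - 2 * pi / real n)"
    and "local_twist X (v k) = kap (v (k - 1) - v k) - kap (v (k + 1) - v k)"
    and "Im (cnj (v (k + 1) - v k) * (v (k - 1) - v k)) > 0"
    and "\<And>x. x \<in> X \<Longrightarrow> Im (cnj (v (k + 1) - v k) * (x - v k)) \<ge> 0"
proof -
  define \<theta> where "\<theta> = 2 * pi / real n"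
  have \<theta>: "0 < \<theta>" "\<theta> < pi" using n by (auto simp: \<theta>_def field_simps)
  have mem: "v j \<in> X" for j unfolding X_def by (intro hull_inc) auto
  have vdiff: "v (k + m) - v k = w * cis (\<theta> * of_int k) * (cis (\<theta> * of_int m) - 1)" for m
    by (simp add: v_def ngon_vertex_def \<theta>_def cis_mult[symmetric] ring_distribs)
  have prod: "cnj (v (k + l) - v k) * (v (k + m) - v k)
      = of_real ((cmod w)\<^sup>2) * ((cis (- (\<theta> * of_int l)) - 1) * (cis (\<theta> * of_int m) - 1))" for l m
  proof -
    have "cnj (v (k + l) - v k) * (v (k + m) - v k) = (w * cnj w) * (cis (\<theta> * of_int k) * cis (- (\<theta> * of_int k)))
       * ((cis (- (\<theta> * of_int l)) - 1) * (cis (\<theta> * of_int m) - 1))"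
      unfolding vdiff by (simp add: cis_cnj mult_ac)
    also have "cis (\<theta> * of_int k) * cis (- (\<theta> * of_int k)) = 1" by (simp add: cis_mult)
    finally show ?thesis by (simp only: complex_norm_square mult_1_right)
  qed
  have Im_half: "Im (cnj (v (k + 1) - v k) * (v (k + m) - v k)) \<ge> 0" if "- int n \<le> m" "m \<le> int n" for m
  proof -
    have "Im ((cis (- (\<theta> * of_int 1)) - 1) * (cis (\<theta> * of_int m) - 1)) = sin (\<theta> * of_int m - \<theta>) - sin (\<theta> * of_int m) + sin \<theta>"
      by (simp add: sin_diff algebra_simps)
    also have "\<dots> \<ge> 0" using ngon_halfplane_aux[of n m] that n unfolding \<theta>_def by simp
    finally show ?thesis unfolding prod by simp
  qed
  \<comment> \<open>The reflection \<open>m \<mapsto> - m\<close> exchanges the two sides at the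
    corner; this is why the range of \<open>m\<close> is symmetric.\<close>
  have Im_half': "Im (cnj (v (k - 1) - v k) * (v (k + m) - v k)) \<le> 0" if "- int n \<le> m" "m \<le> int n" for m
  proof -
    have "Im ((cis (- (\<theta> * of_int (- 1))) - 1) * (cis (\<theta> * of_int m) - 1)) =
      - (sin (\<theta> * of_int (- m) - \<theta>) - sin (\<theta> * of_int (- m)) + sin \<theta>)"
      by (simp add: sin_diff algebra_simps)
    also have "\<dots> \<le> 0" using ngon_halfplane_aux[of n "- m"] that n unfolding \<theta>_def by simp
    finally show ?thesis using prod[of "-1" m] by (simp add: mult_nonneg_nonpos)
  qed
  have all: "\<exists>m. v j = v (k + m) \<and> - int n \<le> m \<and> m \<le> int n" for j
  proof -
    define m where "m = (j - k) mod int n"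
    have "k + m = j + int n * (- ((j - k) div int n))"
      unfolding m_def by (simp add: minus_mult_div_eq_mod[symmetric] algebra_simps)
    moreover have "v (j + int n * q) = v j" for q
    proof -
      have "2 * pi / real n * of_int (j + int n * q) = 2 * pi / real n * of_int j + 2 * pi * of_int q"
        using n by (simp add: field_simps)
      moreover have "cis (2 * pi * of_int q) = 1" by (rule cis_multiple_2pi) simp
      ultimately have "cis (2 * pi / real n * of_int (j + int n * q)) = cis (2 * pi / real n * of_int j)"
        by (metis cis_mult mult.right_neutral)
      then show ?thesis by (simp add: v_def ngon_vertex_def)
    qed
    ultimately have "v j = v (k + m)" by metis
    moreover have "0 \<le> m" "m < int n" using n by (auto simp: m_def)
    ultimately show ?thesis by (intro exI[of _ m]) auto
  qed
  have half1: "Im (cnj (v (k + 1) - v k) * (x - v k)) \<ge> 0" if "x \<in> X" for x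
    using that unfolding X_def
  proof (rule convex_hull_left_halfplane[rotated])
    fix y assume "y \<in> range v"
    then obtain m where "y = v (k + m)" "- int n \<le> m" "m \<le> int n"
      using all by blast
    then show "Im (cnj (v (k + 1) - v k) * (y - v k)) \<ge> 0" using Im_half by simp
  qed
  have half2: "Im (cnj (v (k - 1) - v k) * (x - v k)) \<le> 0" if "x \<in> X" for x
  proof -
    have "Im (cnj (- (v (k - 1) - v k)) * (x - v k)) \<ge> 0"
      using that unfolding X_def
    proof (rule convex_hull_left_halfplane[rotated])
      fix y assume "y \<in> range v"
      then obtain m where "y = v (k + m)" "- int n \<le> m" "m \<le> int n"
        using all by blast
      then have "Im (cnj (v (k - 1) - v k) * (y - v k)) \<le> 0" using Im_half' by simp
      then show "Im (cnj (- (v (k - 1) - v k)) * (y - v k)) \<ge> 0"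
        by (simp only: complex_cnj_minus mult_minus_left uminus_complex.sel neg_0_le_iff_le)
    qed
    then show ?thesis by (simp only: complex_cnj_minus mult_minus_left uminus_complex.sel neg_0_le_iff_le)
  qed
  \<comment> \<open>The two sides at a corner have equal length,
    \<open>2 * sin (\<theta> / 2)\<close> for \<open>w = 1\<close>, and enclose the angle
    \<open>pi - \<theta>\<close>.\<close>
  have "(cis (- \<theta>) - 1) * (cis (- \<theta>) - 1) = of_real (4 * (sin (\<theta> / 2))\<^sup>2) * cis (pi - \<theta>)"
  proof -
    define h where "h = \<theta> / 2"
    have \<theta>h: "\<theta> = 2 * h" by (simp add: h_def)
    have c: "(cos h)\<^sup>2 = 1 - (sin h)\<^sup>2" by (simp add: cos_squared_eq)
    have 1: "cis (- \<theta>) - 1 = Complex (- 2 * (sin h)\<^sup>2) (- 2 * sin h * cos h)"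
      unfolding \<theta>h by (simp add: complex_eq_iff cos_double_sin sin_double)
    have 2: "cis (pi - \<theta>) = Complex (2 * (sin h)\<^sup>2 - 1) (2 * sin h * cos h)"
      unfolding \<theta>h by (simp add: complex_eq_iff cos_double_sin sin_double cos_diff sin_diff)
    show ?thesis unfolding 1 2 h_def[symmetric]
      using c by (simp add: complex_eq_iff) (auto simp: power2_eq_square; algebra)
  qed
  then have u: "cnj (v (k + 1) - v k) * (v (k - 1) - v k) = of_real ((cmod w)\<^sup>2 * (4 * (sin (\<theta> / 2))\<^sup>2)) * cis (pi - \<theta>)"
    using prod[of 1 "- 1"] by simp
  have "sin (\<theta> / 2) > 0" using \<theta> by (intro sin_gt_zero) auto
  then have pos: "(cmod w)\<^sup>2 * (4 * (sin (\<theta> / 2))\<^sup>2) > 0" using w by simp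
  have A: "0 < pi - \<theta>" "pi - \<theta> < pi" using \<theta> by auto
  have "convex X" by (simp add: X_def)
  from corner_values[OF this mem mem mem u pos A half1 half2]
  show "\<exists>\<phi> A. cone_at X (v k) \<phi> A" "local_angle X (v k) = of_real (pi - 2 * pi / real n)"
    "local_twist X (v k) = kap (v (k - 1) - v k) - kap (v (k + 1) - v k)"
    by (simp_all add: \<theta>_def)
  show "Im (cnj (v (k + 1) - v k) * (v (k - 1) - v k)) > 0"
    unfolding u using pos sin_gt_zero[OF A] by simp
  show "Im (cnj (v (k + 1) - v k) * (x - v k)) \<ge> 0" if "x \<in> X" for x
    by (rule half1[OF that])
qed

lemma ngon_other_points:
  assumes n: "n \<ge> 3" and w: "w \<noteq> 0"
    and v: "x \<in> convex hull (range (ngon_vertex n z w))" "x \<notin> range (ngon_vertex n z w)"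
  shows "\<exists>A. (A = pi \<or> A = 2 * pi) \<and> local_angle (convex hull (range (ngon_vertex n z w))) x = of_real A"
    "local_twist (convex hull (range (ngon_vertex n z w))) x = 0"
proof -
  let ?v = "ngon_vertex n z w"
  have "\<not> collinear {?v 0, ?v (0 + 1), ?v (0 - 1)}"
    unfolding collinear_complex_iff using ngon_corner(4)[OF n w, of z 0] by linarith
  from triangle_interior[OF this] have "interior (convex hull (range ?v)) \<noteq> {}"
    using interior_mono[OF hull_mono[of "{?v 0, ?v (0 + 1), ?v (0 - 1)}" "range ?v" convex]] by auto
  moreover have "finite (range ?v)" using n by (subst range_ngon_vertex) auto
  ultimately show "\<exists>A. (A = pi \<or> A = 2 * pi) \<and> local_angle (convex hull (range ?v)) x = of_real A"
    "local_twist (convex hull (range ?v)) x = 0"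
    using hull_nonvertex[of "range ?v" x] v by metis+
qed

section \<open>Counting angles at the vertices\<close>

text \<open>\<open>A\<close>, \<open>B\<close>, \<open>C\<close> fix the naming of the vertices of
  each tile by the angles \<alpha>, \<open>pi / 2 - \<alpha>\<close>, \<open>pi / 2\<close>. A fixed
  choice keeps the counts meaningful for \<open>\<alpha> = pi / 4\<close> too, where
  \<open>A\<close> and \<open>B\<close> could be exchanged.\<close>

locale right_triangle_tiling =
  fixes T :: "complex set set" and P :: "complex set" and \<alpha> :: real
    and A B C :: "complex set \<Rightarrow> complex"
  assumes finite_tiles: "finite T"
    and Union_tiles: "\<Union>T = P"
    and interiors_disjoint: "S \<in> T \<Longrightarrow> S' \<in> T \<Longrightarrow> S \<noteq> S' \<Longrightarrow> interior S \<inter> interior S' = {}"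
    and nondegenerate: "S \<in> T \<Longrightarrow> \<not> collinear {A S, B S, C S}"
    and tile_eq: "S \<in> T \<Longrightarrow> S = convex hull {A S, B S, C S}"
    and angle_A: "S \<in> T \<Longrightarrow> angle_at (B S) (A S) (C S) = \<alpha>"
    and angle_B: "S \<in> T \<Longrightarrow> angle_at (A S) (B S) (C S) = pi / 2 - \<alpha>"
    and angle_C: "S \<in> T \<Longrightarrow> angle_at (A S) (C S) (B S) = pi / 2"
begin

lemma tile_at_vertex:
  assumes S: "S \<in> T"
  shows "\<exists>\<phi> D. cone_at S (A S) \<phi> D" "\<exists>\<phi> D. cone_at S (B S) \<phi> D" "\<exists>\<phi> D. cone_at S (C S) \<phi> D"
    and "local_angle S (A S) = of_real \<alpha>" "local_angle S (B S) = of_real (pi / 2 - \<alpha>)"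
      "local_angle S (C S) = of_real (pi / 2)"
    and "local_twist S (A S) = of_real (orient (A S) (B S) (C S)) * (kap (C S - A S) - kap (B S - A S))"
      "local_twist S (B S) = of_real (orient (A S) (B S) (C S)) * (kap (A S - B S) - kap (C S - B S))"
      "local_twist S (C S) = of_real (orient (A S) (B S) (C S)) * (kap (B S - C S) - kap (A S - C S))"
proof -
  have hull: "convex hull {A S, B S, C S} = S" "convex hull {B S, C S, A S} = S" "convex hull {C S, A S, B S} = S"
    using tile_eq[OF S] by (simp_all add: insert_commute)
  have nc: "\<not> collinear {A S, B S, C S}" "\<not> collinear {B S, C S, A S}" "\<not> collinear {C S, A S, B S}"
    using nondegenerate[OF S] by (simp_all add: insert_commute)
  note a = triangle_vertex[OF nc(1), unfolded hull angle_A[OF S]]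
  note b = triangle_vertex[OF nc(2), unfolded hull angle_at_commute[of "C S" "B S" "A S"] angle_B[OF S]
      orient_cyclic[of "B S" "C S" "A S"]]
  note c = triangle_vertex[OF nc(3), unfolded hull angle_C[OF S]
      orient_cyclic[of "C S" "A S" "B S"] orient_cyclic[of "B S" "C S" "A S"]]
  show "\<exists>\<phi> D. cone_at S (A S) \<phi> D" "\<exists>\<phi> D. cone_at S (B S) \<phi> D" "\<exists>\<phi> D. cone_at S (C S) \<phi> D"
    by (rule a b c)+
  show "local_angle S (A S) = of_real \<alpha>" "local_angle S (B S) = of_real (pi / 2 - \<alpha>)"
      "local_angle S (C S) = of_real (pi / 2)"
    by (rule a b c)+
  show "local_twist S (A S) = of_real (orient (A S) (B S) (C S)) * (kap (C S - A S) - kap (B S - A S))"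
      "local_twist S (B S) = of_real (orient (A S) (B S) (C S)) * (kap (A S - B S) - kap (C S - B S))"
      "local_twist S (C S) = of_real (orient (A S) (B S) (C S)) * (kap (B S - C S) - kap (A S - C S))"
    by (rule a b c)+
qed

lemma vertices_distinct: "S \<in> T \<Longrightarrow> distinct [A S, B S, C S]"
  using nondegenerate[of S] by (auto simp: insert_commute)

lemma closed_tile: "S \<in> T \<Longrightarrow> closed S"
  using tile_eq[of S] by (metis compact_convex_hull compact_imp_closed finite.emptyI finite.insertI finite_imp_compact)

lemma convex_tile: "S \<in> T \<Longrightarrow> convex S"
  using tile_eq[of S] by (metis convex_convex_hull)

lemma interior_tile: "S \<in> T \<Longrightarrow> interior S \<noteq> {}"
  using tile_eq[of S] triangle_interior[OF nondegenerate[of S]] by simp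

lemma tile_at_other:
  assumes S: "S \<in> T" and v: "v \<notin> {A S, B S, C S}"
  shows "v \<in> S \<Longrightarrow> \<exists>\<phi> D. cone_at S v \<phi> D" "\<exists>m::nat. local_angle S v = of_real (pi * real m)" "local_twist S v = 0"
proof -
  have *: "(\<exists>\<phi> D. cone_at S v \<phi> D) \<and> (\<exists>m::nat. local_angle S v = of_real (pi * real m)) \<and> local_twist S v = 0" if "v \<in> S"
  proof -
    have "v \<in> convex hull {A S, B S, C S}" "interior (convex hull {A S, B S, C S}) \<noteq> {}"
      using that interior_tile[OF S] tile_eq[OF S] by simp_all
    then obtain \<phi> D where D: "cone_at S v \<phi> D" "D = pi \<or> D = 2 * pi" "local_angle S v = of_real D" "local_twist S v = 0"
      using hull_nonvertex[of "{A S, B S, C S}" v] v tile_eq[OF S]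
      by (metis finite.emptyI finite.insertI)
    have "D = pi * real 1 \<or> D = pi * real 2"
      using D(2) by auto
    then show ?thesis using D(1,3,4) by metis
  qed
  then show "v \<in> S \<Longrightarrow> \<exists>\<phi> D. cone_at S v \<phi> D" by blast
  show "\<exists>m::nat. local_angle S v = of_real (pi * real m)" "local_twist S v = 0"
    using * local_int_outside[OF closed_tile[OF S]]
    by (cases "v \<in> S"; auto simp: local_angle_def local_twist_def intro: exI[of _ 0])+
qed

lemma cone_at_tile: "S \<in> T \<Longrightarrow> v \<in> S \<Longrightarrow> \<exists>\<phi> D. cone_at S v \<phi> D"
  using tile_at_vertex(1-3)[of S] tile_at_other(1)[of S v] by (cases "v \<in> {A S, B S, C S}") auto

lemma local_angle_sum: "local_angle P v = (\<Sum>S\<in>T. local_angle S v)"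
  unfolding local_angle_def
proof (rule local_int_tiling[where H = of_real])
  show "(complex_of_real has_vector_derivative 1) (at x)" for x
    by (auto intro!: derivative_eq_intros simp: has_vector_derivative_def scaleR_conv_of_real)
qed (simp_all add: finite_tiles Union_tiles interiors_disjoint closed_tile cone_at_tile)

lemma local_twist_sum: "local_twist P v = (\<Sum>S\<in>T. local_twist S v)"
  unfolding local_twist_def
proof (rule local_int_tiling[where H = "\<lambda>\<theta>. cis (- 2 * \<theta>)"])
  show "((\<lambda>\<theta>. cis (- 2 * \<theta>)) has_vector_derivative - 2 * \<i> * cis (- 2 * x)) (at x)" for x
    by (rule has_vector_derivative_cis_double)
  show "- 2 * \<i> * cis (- 2 * (x + 2 * pi)) = - 2 * \<i> * cis (- 2 * x)" for x
    by (simp only: cis_double_periodic)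
qed (simp_all add: finite_tiles Union_tiles interiors_disjoint closed_tile cone_at_tile)

text \<open>\<open>m\<close> collects the half and full turns of the tiles that contain
  \<open>v\<close> without having it as a vertex.\<close>

lemma angle_count:
  obtains m :: nat where "local_angle P v = of_real (\<alpha> * real (card {S \<in> T. A S = v}) +
    (pi / 2 - \<alpha>) * real (card {S \<in> T. B S = v}) + pi / 2 * real (card {S \<in> T. C S = v}) + pi * real m)"
proof -
  define wt where "wt S = \<alpha> * of_bool (A S = v) + (pi / 2 - \<alpha>) * of_bool (B S = v) + pi / 2 * of_bool (C S = v)" for S
  have "\<exists>m::nat. local_angle S v = of_real (wt S + pi * real m)" if S: "S \<in> T" for S
  proof (cases "v \<in> {A S, B S, C S}")
    case True
    then show ?thesis using tile_at_vertex(4-6)[OF S] vertices_distinct[OF S]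
      by (intro exI[of _ 0]) (auto simp: wt_def)
  next
    case False
    then have "wt S = 0" by (auto simp: wt_def)
    then show ?thesis using tile_at_other(2)[OF S False] by simp
  qed
  then obtain m :: "complex set \<Rightarrow> nat" where m: "\<And>S. S \<in> T \<Longrightarrow> local_angle S v = of_real (wt S + pi * real (m S))"
    by metis
  have "local_angle P v = of_real (\<Sum>S\<in>T. wt S + pi * real (m S))"
    unfolding local_angle_sum using m by simp
  also have "(\<Sum>S\<in>T. wt S + pi * real (m S)) = \<alpha> * real (card {S \<in> T. A S = v}) +
    (pi / 2 - \<alpha>) * real (card {S \<in> T. B S = v}) + pi / 2 * real (card {S \<in> T. C S = v}) + pi * real (\<Sum>S\<in>T. m S)"
  proof -
    have "(\<Sum>S\<in>T. of_bool (f S = v)) = real (card {S \<in> T. f S = v})" for f :: "complex set \<Rightarrow> complex"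
      using finite_tiles by (simp add: of_bool_def sum.If_cases Int_def)
    then show ?thesis
      unfolding wt_def by (simp only: sum.distrib sum_distrib_left[symmetric] of_nat_sum)
  qed
  finally show ?thesis using that by blast
qed

end

section \<open>Integer solutions of the angle equations\<close>

text \<open>In the next three lemmas \<open>a = \<alpha> / pi\<close>, and \<open>p\<close>, \<open>q\<close>, \<open>r\<close> count the angles \<open>\<alpha>\<close>,
  \<open>pi / 2 - \<alpha>\<close>, \<open>pi / 2\<close> that meet at a point.\<close>

lemma corner_equation:
  fixes a :: real and n p q r m :: nat
  assumes n: "n \<ge> 5" and a: "0 < a" "a \<le> 1 / 4"
    and eq: "a * real p + (1 / 2 - a) * real q + real r / 2 + real m = 1 - 2 / real n"
  shows "p \<noteq> q"
    and "p < q \<Longrightarrow> a \<in> {1 / real n, 2 / real n, 1 / 6 + 2 / (3 * real n)}"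
    and "p > q \<Longrightarrow> q + r \<le> 1 \<and> a * real (p - q) + real (q + r) / 2 = 1 - 2 / real n"
proof -
  have n0: "0 < 2 / real n" "2 / real n \<le> 2 / 5" using n by (auto simp: field_simps)
  have nn: "a * real p \<ge> 0" "(1 / 2 - a) * real q \<ge> 0" using a by auto
  then have "real m < 1" using eq n0 by linarith
  then have m: "m = 0" by simp
  have eq': "a * (real p - real q) + real (q + r) / 2 = 1 - 2 / real n"
    using eq m by (simp add: algebra_simps add_divide_distrib)
  \<comment> \<open>For \<open>p = q\<close> the integer \<open>q + r\<close> would be
    \<open>2 - 4 / n\<close>, strictly between 1 and 2.\<close>
  show "p \<noteq> q"
  proof
    assume "p = q"
    then have "real (q + r) = 2 - 2 * (2 / real n)" using eq' by simp
    then have "real (q + r) < 2" "real (q + r) > 1" using n0 by linarith+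
    then have "q + r < 2" "q + r > 1" by linarith+
    then show False by simp
  qed
  show "q + r \<le> 1 \<and> a * real (p - q) + real (q + r) / 2 = 1 - 2 / real n" if "p > q"
  proof -
    have "a * (real p - real q) > 0" using a that by simp
    then have "real (q + r) / 2 < 1" using eq' n0 by linarith
    then have "q + r < 2" by simp
    then show ?thesis using eq' that by (simp add: of_nat_diff)
  qed
  show "a \<in> {1 / real n, 2 / real n, 1 / 6 + 2 / (3 * real n)}" if pq: "p < q"
  proof -
    \<comment> \<open>From \<open>d \<le> q + r\<close> and \<open>a \<le> 1 / 4\<close> follows
      \<open>1 < q + r < 4\<close>. The value 2 gives \<open>a * d = 2 / n\<close> with
      \<open>d \<le> 2\<close>, hence the first two angles. The value 3 gives
      \<open>a * d > 1 / 2\<close>, which forces \<open>d = 3\<close> and the third angle.\<close>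
    define d where "d = q - p"
    have d: "real q - real p = real d" "d \<ge> 1" "d \<le> q" using pq by (auto simp: d_def of_nat_diff)
    have e: "real (q + r) / 2 = 1 - 2 / real n + a * real d"
      using eq' d(1) by (simp add: algebra_simps)
    have "a * real d > 0" using a d by simp
    moreover define x where "x = real (q + r)"
    have "a * real d \<le> 1 / 4 * x"
      unfolding x_def using a d by (intro mult_mono) auto
    ultimately have "x > 1" "x < 4" using e[folded x_def] n0 by linarith+
    then have "1 < q + r" "q + r < 4" by (simp_all add: x_def)
    then consider "q + r = 2" | "q + r = 3" by linarith
    then show ?thesis
    proof cases
      case 1
      then have "a * real d = 2 / real n" using e by simp
      moreover have "d = 1 \<or> d = 2" using 1 d by linarith
      ultimately show ?thesis by auto
    next
      case 2
      then have ad: "a * real d = 1 / 2 + 2 / real n" using e by simp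
      have "d = 3"
      proof (rule ccontr)
        assume "d \<noteq> 3"
        then have "d \<le> 2" using 2 d by linarith
        then have "a * real d \<le> 1 / 4 * 2" using a by (intro mult_mono) auto
        then show False using ad n0 by linarith
      qed
      then have "a = 1 / 6 + 2 / (3 * real n)" using ad by (simp add: field_simps)
      then show ?thesis by simp
    qed
  qed
qed

lemma vertex_equation:
  fixes a :: real and p q r m k :: nat
  assumes a: "0 < a" "a \<le> 1 / 4" and pq: "p < q" and k: "k = 1 \<or> k = 2"
    and eq: "a * real p + (1 / 2 - a) * real q + real r / 2 + real m = real k"
  shows "a \<in> {1/4, 1/5, 1/6, 1/8, 1/10, 3/14}"
proof -
  define d where "d = q - p"
  have d: "real q - real p = real d" "d \<ge> 1" "d \<le> q" using pq by (auto simp: d_def of_nat_diff)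
  have "a * real p \<ge> 0" "(1 / 2 - a) * real q > 0" using a pq by auto
  then have "real m < real k" using eq by linarith
  then have "m < k" by simp
  define l where "l = k - m"
  have l: "real k - real m = real l" "l = 1 \<or> l = 2" using k \<open>m < k\<close> by (auto simp: l_def)
  have e: "real (q + r) / 2 = real l + a * real d"
    using eq d(1) l(1) by (simp add: algebra_simps add_divide_distrib)
  have "a * real d > 0" using a d by simp
  then have "real (q + r) > real (2 * l)" using e by simp
  then have gt: "q + r > 2 * l" by linarith
  \<comment> \<open>\<open>l\<close> is the angle, in half turns, left by the tiles without a vertex
    at the point. Now \<open>a = j / (2 * d)\<close>, with \<open>2 * j \<le> d\<close> from
    \<open>a \<le> 1 / 4\<close> and \<open>d \<le> 2 * l + j\<close> from
    \<open>d \<le> q + r\<close>. The finitely many pairs \<open>(j, d)\<close> reduce to six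
    fractions.\<close>
  define j where "j = q + r - 2 * l"
  have j: "q + r = 2 * l + j" "j \<ge> 1" using gt by (auto simp: j_def)
  have ad: "2 * (a * real d) = real j" using e j(1) by (simp add: field_simps)
  have "a * real d \<le> 1 / 4 * real d" using a by (intro mult_right_mono) auto
  then have "real (2 * j) \<le> real d" using ad by simp
  then have dj: "2 * j \<le> d" by linarith
  have dle: "d \<le> 2 * l + j" using d j by linarith
  have aeq: "a = real j / (2 * real d)" using ad d by (simp add: field_simps)
  from l(2) have "(j, d) \<in> {(1,2),(1,3),(2,4),(1,4),(1,5),(2,5),(2,6),(3,6),(3,7),(4,8)}"
  proof
    assume "l = 1"
    then have "j = 1 \<or> j = 2" "d \<le> 4" using dj dle j by linarith+
    then show ?thesis using dj dle \<open>l = 1\<close> by auto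
  next
    assume "l = 2"
    then have "j = 1 \<and> (d = 2 \<or> d = 3 \<or> d = 4 \<or> d = 5) \<or> j = 2 \<and> (d = 4 \<or> d = 5 \<or> d = 6) \<or>
      j = 3 \<and> (d = 6 \<or> d = 7) \<or> j = 4 \<and> d = 8"
      using dj dle j(2) by presburger
    then show ?thesis by fastforce
  qed
  then show ?thesis using aeq by auto
qed

lemma two_equations:
  fixes a :: real and n e s :: nat
  assumes n: "n \<ge> 5" "n \<noteq> 28" and a: "a \<in> {1/4, 1/5, 1/6, 1/8, 1/10, 3/14}"
    and s: "s \<le> 1" and eq: "a * real e + real s / 2 = 1 - 2 / real n"
  shows "a \<in> {1 / real n, 2 / real n, 1 / 6 + 2 / (3 * real n)} \<or> n \<in> {5, 7} \<and> a = 1 / 2 - 2 / real n"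
proof -
  \<comment> \<open>With \<open>a = x / y\<close>, \<open>z = y / 2\<close> and
    \<open>N = 2 * y\<close> the equation, cleared of denominators, says that \<open>n\<close>
    divides \<open>N\<close> with the quotient \<open>u\<close>. Since \<open>n \<ge> 5\<close>, few
    values of \<open>u\<close> remain.\<close>
  have key: "\<exists>u::int. int n * u = int N \<and> u = int y - int x * int e - int z * int s"
    if "a * real y = real x" "real y = 2 * real z" "2 * real y = real N" for x y z N :: nat
  proof -
    have "real y * (a * real e + real s / 2) = real y * (1 - 2 / real n)" using eq by simp
    then have "(a * real y) * real e + (real y / 2) * real s = real y - 2 * real y / real n"
      by (simp add: algebra_simps)
    then have "real x * real e + real z * real s = real y - real N / real n" using that by simp
    then have "real n * (real y - real x * real e - real z * real s) = real N"
      using n by (simp add: field_simps)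
    then have "real_of_int (int n * (int y - int x * int e - int z * int s)) = real_of_int (int N)"
      by simp
    then show ?thesis by (simp only: of_int_eq_iff) blast
  qed
  have le: "u \<ge> 1 \<and> 5 * u \<le> N" if "int n * u = N" "N > 0" for u N
  proof -
    have "u > 0" using that n by (simp add: zero_less_mult_iff flip: that(1))
    moreover have "5 * u \<le> int n * u" using n \<open>u > 0\<close> by (intro mult_right_mono) auto
    ultimately show ?thesis using that by simp
  qed
  have s': "s = 0 \<or> s = 1" using s by auto
  from a consider "a = 1/4" | "a = 1/5" | "a = 1/6" | "a = 1/8" | "a = 1/10" | "a = 3/14" by blast
  then show ?thesis
  proof cases
    case 1
    then obtain u where u: "int n * u = 8" "u = 4 - 1 * int e - 2 * int s" using key[of 4 1 2 8] by auto
    have "u = 1" using le[of u 8] u by presburger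
    then have "n = 8" using u(1) n by (safe; presburger)
    then show ?thesis using 1 by simp
  next
    case 2
    then obtain u where u: "int n * u = 20" "u = 10 - 2 * int e - 5 * int s" using key[of 10 2 5 20] by auto
    have "u = 1 \<or> u = 2 \<or> u = 3 \<or> u = 4" using le[of u 20] u by presburger
    then have "n = 5 \<or> n = 10 \<or> n = 20" using u(1) n by (safe; presburger)
    then show ?thesis using 2 by auto
  next
    case 3
    then obtain u where u: "int n * u = 12" "u = 6 - 1 * int e - 3 * int s" using key[of 6 1 3 12] by auto
    have "u = 1 \<or> u = 2" using le[of u 12] u by presburger
    then have "n = 6 \<or> n = 12" using u(1) n by (safe; presburger)
    then show ?thesis using 3 by auto
  next
    case 4
    then obtain u where u: "int n * u = 16" "u = 8 - 1 * int e - 4 * int s" using key[of 8 1 4 16] by auto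
    have "u = 1 \<or> u = 2 \<or> u = 3" using le[of u 16] u by presburger
    then have "n = 8 \<or> n = 16" using u(1) n by (safe; presburger)
    then show ?thesis using 4 by auto
  next
    case 5
    \<comment> \<open>The pentagon exception arises here: \<open>n = 5\<close> with
      \<open>1/10 = 1/2 - 2/5\<close>.\<close>
    then obtain u where u: "int n * u = 20" "u = 10 - 1 * int e - 5 * int s" using key[of 10 1 5 20] by auto
    have "u = 1 \<or> u = 2 \<or> u = 3 \<or> u = 4" using le[of u 20] u by presburger
    then have "n = 5 \<or> n = 10 \<or> n = 20" using u(1) n by (safe; presburger)
    then show ?thesis using 5 by auto
  next
    case 6
    \<comment> \<open>The heptagon exception is \<open>3/14 = 1/2 - 2/7\<close>; for
      \<open>n = 14\<close> the fraction equals \<open>1/6 + 2/42\<close>. The quotient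
      \<open>u = 1\<close> is attained by \<open>e = 2\<close>, \<open>s = 1\<close>: this is the
      excluded \<open>n = 28\<close>.\<close>
    then obtain u where u: "int n * u = 28" "u = 14 - 3 * int e - 7 * int s" using key[of 14 3 7 28] by auto
    have "u = 1 \<or> u = 2 \<or> u = 3 \<or> u = 4 \<or> u = 5" using le[of u 28] u by presburger
    then have "n = 7 \<or> n = 14" using u(1) n by (safe; presburger)
    then show ?thesis using 6 by auto
  qed
qed

section \<open>From angle counts to the candidate angles\<close>

context right_triangle_tiling
begin

lemma angle_cases:
  assumes n: "n \<ge> 5" "n \<noteq> 28" and w: "w \<noteq> 0" and \<alpha>: "0 < \<alpha>" "\<alpha> \<le> pi / 4"
    and P: "P = convex hull (range (ngon_vertex n z w))"
  shows "\<alpha> \<in> {pi / real n, 2 * pi / real n, pi / 6 + 2 * pi / (3 * real n)} \<or>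
    n \<in> {5, 7} \<and> \<alpha> = pi / 2 - 2 * pi / real n"
proof -
  define a where "a = \<alpha> / pi"
  have \<alpha>a: "\<alpha> = pi * a" by (simp add: a_def)
  have a: "0 < a" "a \<le> 1 / 4" using \<alpha> by (simp_all add: a_def field_simps)
  define p where "p v = card {S \<in> T. A S = v}" for v
  define q where "q v = card {S \<in> T. B S = v}" for v
  define r where "r v = card {S \<in> T. C S = v}" for v
  have count: "\<exists>m::nat. a * real (p v) + (1 / 2 - a) * real (q v) + real (r v) / 2 + real m = x"
    if "local_angle P v = of_real (pi * x)" for v x
  proof -
    obtain m :: nat where "local_angle P v = of_real (\<alpha> * real (p v) +
        (pi / 2 - \<alpha>) * real (q v) + pi / 2 * real (r v) + pi * real m)"
      using angle_count[of v] unfolding p_def q_def r_def by blast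
    then have "\<alpha> * real (p v) + (pi / 2 - \<alpha>) * real (q v) + pi / 2 * real (r v) + pi * real m = pi * x"
      using that by (metis of_real_eq_iff)
    then have "pi * (a * real (p v) + (1 / 2 - a) * real (q v) + real (r v) / 2 + real m) = pi * x"
      unfolding \<alpha>a by (simp add: algebra_simps)
    then show ?thesis by (metis mult_cancel_left pi_neq_zero)
  qed
  have n3: "n \<ge> 3" using n by simp
  have corner: "\<exists>m::nat. a * real (p (ngon_vertex n z w k)) + (1 / 2 - a) * real (q (ngon_vertex n z w k))
      + real (r (ngon_vertex n z w k)) / 2 + real m = 1 - 2 / real n" for k
    using ngon_corner(2)[OF n3 w, of z k]
    by (intro count) (simp add: P right_diff_distrib mult.commute)
  have conv: "\<alpha> \<in> {pi / real n, 2 * pi / real n, pi / 6 + 2 * pi / (3 * real n)}"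
    if "a \<in> {1 / real n, 2 / real n, 1 / 6 + 2 / (3 * real n)}"
    using that unfolding \<alpha>a by (auto simp: algebra_simps)
  show ?thesis
  proof (cases "\<exists>k. p (ngon_vertex n z w k) < q (ngon_vertex n z w k)")
    case True
    then show ?thesis using corner corner_equation(2)[OF n(1) a] conv by blast
  next
    case False
    define u where "u = ngon_vertex n z w 0"
    have pq: "p u > q u" using corner[of 0] corner_equation(1)[OF n(1) a] False unfolding u_def
      by (metis linorder_neqE_nat)
    then have ue: "q u + r u \<le> 1" "a * real (p u - q u) + real (q u + r u) / 2 = 1 - 2 / real n"
      using corner[of 0] corner_equation(3)[OF n(1) a] unfolding u_def by blast+
    have "\<exists>v. p v < q v"
    proof (rule ccontr)
      assume no: "\<not> (\<exists>v. p v < q v)"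
      \<comment> \<open>Each tile has one \<open>A\<close> and one \<open>B\<close>, so over
        \<open>V\<close> both counts total \<open>card T\<close>; the strict surplus at
        \<open>u\<close> must be compensated elsewhere.\<close>
      define V where "V = insert u (A ` T \<union> B ` T)"
      have V_sub: "A ` T \<subseteq> V" "B ` T \<subseteq> V" by (auto simp: V_def)
      have fV: "finite V" using finite_tiles by (simp add: V_def)
      have tot: "(\<Sum>v\<in>V. card {S \<in> T. f S = v}) = card T" if "f ` T \<subseteq> V" for f :: "complex set \<Rightarrow> complex"
        using card_eq_sum[of T] sum.group[OF finite_tiles fV that, of "\<lambda>_. 1::nat"] by simp
      have "(\<Sum>v\<in>V. p v) = (\<Sum>v\<in>V. q v)"
        unfolding p_def q_def using tot[of A] tot[of B] V_sub by simp
      moreover have "(\<Sum>v\<in>V. q v) < (\<Sum>v\<in>V. p v)"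
        using fV no pq by (intro sum_strict_mono_ex1) (auto simp: V_def not_less)
      ultimately show False by simp
    qed
    then obtain v where v: "p v < q v" by blast
    \<comment> \<open>Some tile has its \<open>B\<close> at \<open>v\<close>, so \<open>v\<close>
      lies in the polygon. It is not a corner, as no corner has more \<beta>; so the angle there is
      \<open>pi\<close> or \<open>2 * pi\<close>.\<close>
    then have "q v \<noteq> 0" by simp
    then obtain S where S: "S \<in> T" "B S = v" unfolding q_def by (metis (mono_tags, lifting) card.empty Collect_empty_eq)
    have "v \<in> S" using S tile_eq[OF S(1)] hull_inc[of v "{A S, B S, C S}"] by auto
    then have "v \<in> P" using S Union_tiles by blast
    moreover have "v \<notin> range (ngon_vertex n z w)" using False v by blast
    ultimately obtain D where "D = pi \<or> D = 2 * pi" "local_angle P v = of_real D"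
      using ngon_other_points(1)[OF n3 w] unfolding P by blast
    then obtain k :: nat where k: "k = 1 \<or> k = 2" "local_angle P v = of_real (pi * real k)"
      by (metis mult.commute mult_1 of_nat_1 of_nat_numeral)
    from count[OF k(2)] vertex_equation[OF a v k(1)]
    have "a \<in> {1/4, 1/5, 1/6, 1/8, 1/10, 3/14}" by blast
    from two_equations[OF n this ue] consider
      "a \<in> {1 / real n, 2 / real n, 1 / 6 + 2 / (3 * real n)}" | "n \<in> {5, 7}" "a = 1 / 2 - 2 / real n" by blast
    then show ?thesis
    proof cases
      case 1
      then show ?thesis using conv by blast
    next
      case 2
      have "\<alpha> = pi / 2 - 2 * pi / real n" unfolding \<alpha>a 2(2) by (simp add: algebra_simps)
      then show ?thesis using 2(1) by blast
    qed
  qed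
qed

end

section \<open>Semilinear maps of the plane\<close>

text \<open>The numbers 1 and \<open>y\<close> are linearly independent over the rationals, so their
  images under a rational-linear map can be prescribed.\<close>

lemma additive_separating_irrational:
  fixes y :: real
  assumes "y \<notin> \<rat>"
  obtains f :: "real \<Rightarrow> real" where "\<And>a b. f (a + b) = f a + f b" "f 1 = 1" "f y = 0"
proof -
  let ?s = "\<lambda>(q::rat) (x::real). of_rat q * x"
  interpret V: vector_space ?s
    by unfold_locales (auto simp: algebra_simps of_rat_add of_rat_mult)
  interpret VP: vector_space_pair ?s ?s ..
  have "y \<noteq> 0" using assms by auto
  then have "y \<noteq> of_rat q" for q using assms by (metis Rats_of_rat)
  then have "y \<notin> V.span {1}" by (auto simp: V.span_singleton)
  moreover have "V.independent {1}" by (intro V.independent_insertI V.independent_empty) (simp add: V.span_empty)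
  ultimately have "V.independent {y, 1}" by (rule V.independent_insertI)
  from VP.linear_independent_extend[OF this, of "\<lambda>x. if x = 1 then 1 else 0"]
  obtain g where g: "Vector_Spaces.linear ?s ?s g" "g y = (if y = 1 then 1 else 0)" "g 1 = 1" by auto
  have "y \<noteq> 1" using assms by auto
  then show ?thesis
    using that[of g] g(2,3) module_hom.add[OF g(1)[unfolded Vector_Spaces.linear_iff_module_hom]] by simp
qed

lemma sum_shift_periodic:
  fixes a :: "nat \<Rightarrow> complex"
  assumes "a n = a 0"
  shows "(\<Sum>k<n. a (Suc k)) = (\<Sum>k<n. a k)"
proof -
  have "(\<Sum>k<n. a (Suc k)) + a 0 = (\<Sum>k<n. a k) + a n"
    by (metis sum.lessThan_Suc sum.lessThan_Suc_shift add.commute)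
  then show ?thesis using assms by simp
qed

lemma sum_powers_root_unity:
  fixes u :: complex
  assumes "u ^ n = 1" "u \<noteq> 1"
  shows "(\<Sum>k<n. u ^ k) = 0"
  using geometric_sum[OF assms(2), of n] assms(1) by simp

text \<open>An additive \<open>f\<close> with \<open>f y \<noteq> y * f 1\<close>, where \<open>y = 2 * cos (2 * pi / n)\<close>, acts coordinatewise on the
  plane as the sum of its components on which \<open>\<zeta>\<close> acts as \<open>\<zeta> ^ j\<close>, \<open>j < n\<close>.
  At \<open>1\<close> the component \<open>j = 0\<close> vanishes, and \<open>j = 1\<close> and \<open>j = n - 1\<close> commute with
  multiplication by \<open>y = \<zeta> + cnj \<zeta>\<close>; so another component is nonzero at \<open>1\<close>.\<close>

lemma semilinear_map:
  fixes n :: nat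
  assumes n: "n \<ge> 3" and irr: "2 * cos (2 * pi / real n) \<notin> \<rat>"
  defines "\<zeta> \<equiv> cis (2 * pi / real n)"
  obtains G :: "complex \<Rightarrow> complex" and j :: nat where "2 \<le> j" "j \<le> n - 2"
    "\<And>x y. G (x + y) = G x + G y" "\<And>x. G (\<zeta> * x) = \<zeta> ^ j * G x"
    "\<And>x. G (\<i> * x) = \<i> * G x" "\<And>x. G (cnj x) = cnj (G x)" "G 1 = 1"
proof -
  define y where "y = 2 * cos (2 * pi / real n)"
  obtain f :: "real \<Rightarrow> real" where f: "\<And>a b. f (a + b) = f a + f b" "f 1 = 1" "f y = 0"
    using additive_separating_irrational[OF irr] unfolding y_def by blast
  have f0: "f 0 = 0" using f(1)[of 0 0] by simp
  have fm: "f (- a) = - f a" for a using f(1)[of a "- a"] f0 by (simp add: eq_neg_iff_add_eq_0 add.commute)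
  \<comment> \<open>Acting on both coordinates alike makes \<open>F\<close> commute with
    \<open>\<i>\<close> and with conjugation.\<close>
  define F where "F z = Complex (f (Re z)) (f (Im z))" for z
  have Fadd: "F (x + z) = F x + F z" for x z by (simp add: F_def f(1) complex_eq_iff)
  have Fi: "F (\<i> * x) = \<i> * F x" for x by (simp add: F_def fm complex_eq_iff)
  have Fc: "F (cnj x) = cnj (F x)" for x by (simp add: F_def fm complex_eq_iff)
  define c where "c = cnj \<zeta>"
  have c\<zeta>: "c * \<zeta> = 1" by (simp add: c_def \<zeta>_def cis_cnj cis_mult)
  have \<zeta>n: "\<zeta> ^ n = 1" using n by (simp add: \<zeta>_def Complex.DeMoivre)
  have cn: "c ^ n = 1" unfolding c_def complex_cnj_power[symmetric] \<zeta>n by simp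
  have pw: "c ^ m * \<zeta> ^ m = 1" for m by (simp flip: power_mult_distrib add: c\<zeta>)
  have cne: "c ^ k \<noteq> 1" if "0 < k" "k < n" for k
  proof
    assume "c ^ k = 1"
    then have "\<zeta> ^ k = 1" using pw[of k] by simp
    then have "cos (real k * (2 * pi / real n)) = 1" by (simp add: \<zeta>_def Complex.DeMoivre complex_eq_iff)
    then obtain m :: int where "real k * (2 * pi / real n) = of_int m * 2 * pi"
      using cos_one_2pi_int by auto
    then have "real k = of_int m * real n" using n by (simp add: field_simps)
    then have "int k = m * int n" by (metis of_int_eq_iff of_int_mult of_int_of_nat_eq)
    then show False using that by (metis dvd_triv_right int_dvd_int_iff nat_dvd_not_less)
  qed
  \<comment> \<open>This is \<open>n\<close> times the Fourier projection of \<open>F\<close> to the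
    part on which \<zeta> acts as \<open>\<zeta> ^ j\<close>; \<open>c\<close> is the inverse of
    \<zeta>.\<close>
  define G where "G j x = (\<Sum>k<n. c ^ (j * k) * F (\<zeta> ^ k * x))" for j x
  have Gadd: "G j (x + z) = G j x + G j z" for j x z
    by (simp add: G_def Fadd distrib_left sum.distrib)
  have Gi: "G j (\<i> * x) = \<i> * G j x" for j x
    by (simp add: G_def sum_distrib_left Fi mult.left_commute[of _ \<i>])
  have G\<zeta>: "G j (\<zeta> * x) = \<zeta> ^ j * G j x" for j x
  proof -
    define a where "a k = \<zeta> ^ j * (c ^ (j * k) * F (\<zeta> ^ k * x))" for k
    have "c ^ (j * k) * F (\<zeta> ^ k * (\<zeta> * x)) = a (Suc k)" for k
      using pw[of j] by (simp add: a_def power_add mult_ac)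
    then have "G j (\<zeta> * x) = (\<Sum>k<n. a (Suc k))" by (simp add: G_def)
    also have "\<dots> = (\<Sum>k<n. a k)"
      by (rule sum_shift_periodic) (simp add: a_def \<zeta>n cn power_mult[of c n j] mult.commute[of j n])
    finally show ?thesis by (simp add: G_def a_def sum_distrib_left)
  qed
  have Gc: "G j (cnj x) = cnj (G j x)" for j x
  proof -
    define b where "b k = \<zeta> ^ (j * k) * F (c ^ k * cnj x)" for k
    have inv: "c ^ (n - k) = \<zeta> ^ k" "\<zeta> ^ (n - k) = c ^ k" if "k \<le> n" for k
    proof -
      have "c ^ (n - k) = c ^ (n - k) * (c ^ k * \<zeta> ^ k)" by (simp add: pw)
      also have "\<dots> = c ^ n * \<zeta> ^ k" using that by (simp add: mult.assoc[symmetric] power_add[symmetric])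
      finally show "c ^ (n - k) = \<zeta> ^ k" by (simp add: cn)
      have "\<zeta> ^ (n - k) = \<zeta> ^ (n - k) * (\<zeta> ^ k * c ^ k)" using pw[of k] by (simp add: mult.commute)
      also have "\<dots> = \<zeta> ^ n * c ^ k" using that by (simp add: mult.assoc[symmetric] power_add[symmetric])
      finally show "\<zeta> ^ (n - k) = c ^ k" by (simp add: \<zeta>n)
    qed
    have "c ^ (j * k) * F (\<zeta> ^ k * cnj x) = b (n - k)" if "k < n" for k
      using inv[of k] that by (simp add: b_def power_mult mult.commute[of j])
    then have "G j (cnj x) = (\<Sum>k<n. b (n - k))" by (simp add: G_def)
    also have "\<dots> = (\<Sum>k<n. b (n - Suc k))"
      by (rule sum_shift_periodic[symmetric])
        (simp add: b_def \<zeta>n cn power_mult[of \<zeta> n j] mult.commute[of j n])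
    also have "\<dots> = (\<Sum>k<n. b k)" by (rule sum.nat_diff_reindex)
    also have "\<dots> = cnj (G j x)"
      by (simp add: G_def b_def c_def flip: Fc)
    finally show ?thesis .
  qed
  have Gsum: "(\<Sum>j<n. G j x) = of_nat n * F x" for x
  proof -
    have "(\<Sum>j<n. G j x) = (\<Sum>k<n. \<Sum>j<n. c ^ (j * k) * F (\<zeta> ^ k * x))"
      unfolding G_def by (rule sum.swap)
    also have "\<dots> = (\<Sum>k<n. if k = 0 then of_nat n * F x else 0)"
    proof (rule sum.cong[OF refl])
      fix k assume "k \<in> {..<n}"
      have "(\<Sum>j<n. (c ^ k) ^ j) = 0" if "k \<noteq> 0"
        using sum_powers_root_unity[of "c ^ k" n] cne[of k] that \<open>k \<in> {..<n}\<close>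
        by (simp add: power_mult[symmetric] mult.commute[of k n]) (simp add: power_mult cn)
      then show "(\<Sum>j<n. c ^ (j * k) * F (\<zeta> ^ k * x)) = (if k = 0 then of_nat n * F x else 0)"
        by (cases "k = 0") (simp_all add: sum_distrib_right[symmetric] power_mult[symmetric] mult.commute)
    qed
    also have "\<dots> = of_nat n * F x" using n by simp
    finally show ?thesis .
  qed
  have y\<zeta>: "of_real y = \<zeta> + c" by (simp add: y_def \<zeta>_def c_def complex_eq_iff)
  have Gy: "G j (of_real y) = (\<zeta> ^ j + c ^ j) * G j 1" for j
  proof -
    have 1: "G j \<zeta> = \<zeta> ^ j * G j 1" using G\<zeta>[of j 1] by simp
    have "G j c = cnj (G j \<zeta>)" unfolding c_def by (rule Gc)
    also have "\<dots> = c ^ j * G j 1" using Gc[of j 1] by (simp add: 1 c_def)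
    finally show ?thesis unfolding y\<zeta> Gadd 1 by (simp add: distrib_right)
  qed
  \<comment> \<open>\<open>G 0\<close> takes the same value on all powers of \<zeta>, whose sum over
    a full period is 0.\<close>
  have G0: "G 0 1 = 0"
  proof -
    have "G 0 0 = 0" using Gadd[of 0 0 0] by simp
    have "G 0 (\<Sum>k<m. \<zeta> ^ k) = of_nat m * G 0 1" for m
    proof (induction m)
      case (Suc m)
      have "G 0 (\<zeta> ^ k) = G 0 1" for k by (induction k) (simp_all add: G\<zeta>)
      then show ?case using Suc by (simp add: Gadd distrib_right add.commute)
    qed (simp add: \<open>G 0 0 = 0\<close>)
    moreover have "\<zeta> \<noteq> 1" using cne[of 1] n c\<zeta> by auto
    ultimately have "of_nat n * G 0 1 = 0"
      using sum_powers_root_unity[OF \<zeta>n] \<open>G 0 0 = 0\<close> by metis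
    then show ?thesis using n by simp
  qed
  have "\<exists>j. 2 \<le> j \<and> j \<le> n - 2 \<and> G j 1 \<noteq> 0"
  proof (rule ccontr)
    assume none: "\<not> (\<exists>j. 2 \<le> j \<and> j \<le> n - 2 \<and> G j 1 \<noteq> 0)"
    have "G j (of_real y) = of_real y * G j 1" if jn: "j < n" for j
    proof -
      consider "j = 0" | "j = 1" | "2 \<le> j" "j \<le> n - 2" | "j = n - 1" using jn by linarith
      then show ?thesis
      proof cases
        case 1
        then show ?thesis using Gy[of 0] G0 by simp
      next
        case 2
        then show ?thesis using Gy[of 1] y\<zeta> by simp
      next
        case 3
        then show ?thesis using Gy[of j] none by auto
      next
        case 4
        have "\<zeta> * \<zeta> ^ (n - 1) = 1" "c * c ^ (n - 1) = 1"
          using \<zeta>n cn n by (simp_all flip: power_Suc)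
        then have "\<zeta> ^ (n - 1) = c" "c ^ (n - 1) = \<zeta>"
          using c\<zeta> by (metis mult.assoc mult.commute mult_1)+
        then show ?thesis using Gy[of j] y\<zeta> 4 by (simp add: add.commute)
      qed
    qed
    then have "(\<Sum>j<n. G j (of_real y)) = of_real y * (\<Sum>j<n. G j 1)"
      by (simp add: sum_distrib_left)
    then have "F (of_real y) = of_real y * F 1" unfolding Gsum using n by simp
    \<comment> \<open>Here \<open>F 1 = 1\<close> and \<open>F y = 0\<close> by the choice of
      \<open>f\<close>.\<close>
    then have "y = 0" using f f0 by (simp add: F_def complex_eq_iff)
    then show False using irr by (simp add: y_def)
  qed
  then obtain j where j: "2 \<le> j" "j \<le> n - 2" "G j 1 \<noteq> 0" by blast
  \<comment> \<open>\<open>G j 1\<close> is real, so dividing by it preserves the commutation with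
    conjugation.\<close>
  have "cnj (G j 1) = G j 1" using Gc[of j 1] by simp
  with j show ?thesis
    by (intro that[of j "\<lambda>x. G j x / G j 1"]) (simp_all add: Gadd G\<zeta> Gi Gc add_divide_distrib)
qed

text \<open>The vanishing sum of the powers of \<zeta>, centred by a power of \<open>c\<close>,
  becomes a monic integer polynomial in \<open>x = \<zeta> + c\<close>. A rational \<open>x\<close>
  would thus be an integer, but it lies strictly between 0 and 1 for \<open>n = 5\<close> and
  between 1 and 2 for \<open>n = 7\<close>.\<close>

lemma cos_pentagon_heptagon_irrational:
  assumes "n \<in> {5, 7::nat}"
  shows "2 * cos (2 * pi / real n) \<notin> \<rat>"
proof
  define x where "x = 2 * cos (2 * pi / real n)"
  define \<zeta> where "\<zeta> = cis (2 * pi / real n)"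
  define c where "c = cnj \<zeta>"
  assume "2 * cos (2 * pi / real n) \<in> \<rat>"
  then have rat: "x \<in> \<rat>" by (simp add: x_def)
  have c\<zeta>: "\<zeta> * c = 1" by (simp add: c_def \<zeta>_def cis_cnj cis_mult)
  have \<zeta>n: "\<zeta> ^ n = 1" using assms by (auto simp: \<zeta>_def Complex.DeMoivre)
  have x\<zeta>: "of_real x = \<zeta> + c" by (simp add: x_def \<zeta>_def c_def complex_eq_iff)
  have range: "sin (2 * pi / real n) > 0" using assms by (intro sin_gt_zero) auto
  then have "\<zeta> \<noteq> 1" by (auto simp: \<zeta>_def complex_eq_iff)
  then have sum0: "(\<Sum>k<n. \<zeta> ^ k) = 0" by (rule sum_powers_root_unity[OF \<zeta>n])
  have "algebraic_int x"
  proof (cases "n = 5")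
    case True
    have "c\<^sup>2 * (\<Sum>k<5. \<zeta> ^ k) = 0" using sum0 True by simp
    moreover have "c\<^sup>2 * (\<Sum>k<5. \<zeta> ^ k) = (\<zeta> + c)\<^sup>2 + (\<zeta> + c) - 1"
      using c\<zeta> by (simp add: eval_nat_numeral) algebra
    ultimately have "of_real (x\<^sup>2 + x - 1) = (0::complex)" using x\<zeta> by simp
    then have "x\<^sup>2 + x - 1 = 0" by (simp only: of_real_eq_0_iff)
    then show ?thesis
      by (intro algebraic_int.intros[of "[:-1, 1, 1:]"])
        (auto simp: power2_eq_square algebra_simps coeff_pCons split: nat.splits)
  next
    case False
    then have 7: "n = 7" using assms by auto
    have "c ^ 3 * (\<Sum>k<7. \<zeta> ^ k) = 0" using sum0 7 by simp
    moreover have "c ^ 3 * (\<Sum>k<7. \<zeta> ^ k) = (\<zeta> + c) ^ 3 + (\<zeta> + c)\<^sup>2 - 2 * (\<zeta> + c) - 1"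
      using c\<zeta> by (simp add: eval_nat_numeral) algebra
    ultimately have "of_real (x ^ 3 + x\<^sup>2 - 2 * x - 1) = (0::complex)" using x\<zeta> by simp
    then have "x ^ 3 + x\<^sup>2 - 2 * x - 1 = 0" by (simp only: of_real_eq_0_iff)
    then show ?thesis
      by (intro algebraic_int.intros[of "[:-1, -2, 1, 1:]"])
        (auto simp: eval_nat_numeral algebra_simps coeff_pCons split: nat.splits)
  qed
  then have "x \<in> \<int>" using rat by (rule rational_algebraic_int_is_int)
  then obtain m where m: "x = of_int m" by (auto elim: Ints_cases)
  have "\<exists>l::int. of_int l < x \<and> x < of_int l + 1"
  proof (cases "n = 5")
    case True
    have "cos (2 * pi / 5) > 0" by (intro cos_gt_zero) auto
    moreover have "cos (2 * pi / 5) < cos (pi / 3)" by (intro cos_monotone_0_pi) auto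
    ultimately show ?thesis using True by (intro exI[of _ 0]) (simp add: x_def cos_60)
  next
    case False
    then have 7: "n = 7" using assms by auto
    have "cos (2 * pi / 7) > cos (pi / 3)" by (intro cos_monotone_0_pi) auto
    moreover have "cos (2 * pi / 7) < cos 0" by (intro cos_monotone_0_pi) auto
    ultimately show ?thesis using 7 by (intro exI[of _ 1]) (simp add: x_def cos_60)
  qed
  then obtain l :: int where "of_int l < real_of_int m" "real_of_int m < of_int l + 1" using m by auto
  then have "l < m" "real_of_int m < real_of_int (l + 1)" by simp_all
  then show False by simp
qed

section \<open>Edge directions\<close>

lemma kap_mult: "kap (x * y) = kap x * kap y"
  by (simp add: kap_def)

lemma kap_scaleR: "r \<noteq> 0 \<Longrightarrow> kap (r *\<^sub>R x) = kap x"
  by (simp add: kap_def scaleR_conv_of_real)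

lemma kap_closed_segment:
  assumes "p \<in> closed_segment a b" "q \<in> closed_segment a b" "p \<noteq> q"
  shows "kap (p - q) = kap (a - b)"
proof -
  obtain u v where pq: "p = (1 - u) *\<^sub>R a + u *\<^sub>R b" "q = (1 - v) *\<^sub>R a + v *\<^sub>R b"
    using assms(1,2) by (auto simp: in_segment)
  have eq: "p - q = (v - u) *\<^sub>R (a - b)" unfolding pq by (simp add: algebra_simps)
  then have "v - u \<noteq> 0" using assms(3) by auto
  then show ?thesis unfolding eq by (rule kap_scaleR)
qed

text \<open>Three sides cover an infinite segment, so one of them shares two points with it.\<close>

lemma triangle_edge_parallel:
  assumes sub: "closed_segment x y \<subseteq> frontier (convex hull {a, b, c})" and "x \<noteq> y"
  shows "kap (x - y) \<in> {kap (a - b), kap (b - c), kap (c - a)}"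
proof -
  have "closed_segment x y \<subseteq> closed_segment a b \<union> closed_segment b c \<union> closed_segment c a"
    using sub frontier_of_triangle[of a b c] by simp
  then have "closed_segment x y = (closed_segment x y \<inter> closed_segment a b) \<union>
    (closed_segment x y \<inter> closed_segment b c) \<union> (closed_segment x y \<inter> closed_segment c a)" by blast
  moreover have "infinite (closed_segment x y)" using assms(2) by simp
  ultimately have "infinite (closed_segment x y \<inter> closed_segment a b) \<or>
    infinite (closed_segment x y \<inter> closed_segment b c) \<or> infinite (closed_segment x y \<inter> closed_segment c a)"
    by (metis finite_Un)
  moreover have "kap (x - y) = kap (d - e)" if inf: "infinite (closed_segment x y \<inter> closed_segment d e)" for d e
  proof -
    obtain p where p: "p \<in> closed_segment x y \<inter> closed_segment d e"
      using infinite_imp_nonempty[OF inf] by blast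
    have "infinite (closed_segment x y \<inter> closed_segment d e - {p})" using inf by simp
    then obtain q where q: "q \<in> closed_segment x y \<inter> closed_segment d e - {p}"
      using infinite_imp_nonempty by blast
    then show ?thesis
      using kap_closed_segment[of p x y q] kap_closed_segment[of p d e q] p by auto
  qed
  ultimately show ?thesis by blast
qed

lemma boundary_halfplane_not_interior:
  assumes half: "\<And>x. x \<in> X \<Longrightarrow> Im (cnj d * (x - a)) \<ge> 0" and "d \<noteq> 0" "Im (cnj d * (p - a)) = 0"
  shows "p \<notin> interior X"
proof
  assume "p \<in> interior X"
  then obtain e where e: "e > 0" "cball p e \<subseteq> X" by (auto simp: mem_interior_cball)
  define q where "q = p - of_real (e / cmod d) * (\<i> * d)"
  have "dist p q = e" using e(1) assms(2) by (simp add: q_def dist_norm norm_mult norm_divide)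
  then have "q \<in> X" using e by auto
  have "cnj d * (q - a) = cnj d * (p - a) - of_real (e / cmod d) * (\<i> * (d * cnj d))"
    by (simp add: q_def algebra_simps)
  then have "Im (cnj d * (q - a)) = - (e / cmod d * (cmod d)\<^sup>2)"
    using assms(3) unfolding complex_norm_square[symmetric] by simp
  moreover have "e / cmod d * (cmod d)\<^sup>2 > 0" using e(1) assms(2) by simp
  ultimately show False using half[OF \<open>q \<in> X\<close>] by simp
qed

lemma convex_disjoint_interior:
  fixes S S' :: "complex set"
  assumes "convex S'" "closed S'" "interior S' \<noteq> {}" "interior S \<inter> interior S' = {}"
  shows "interior S \<inter> S' = {}"
proof -
  have "interior S \<inter> closure (interior S') = {}"
    using assms(4) open_Int_closure_eq_empty[OF open_interior] by blast
  then show ?thesis using convex_closure_interior[OF assms(1,3)] closure_closed[OF assms(2)] by simp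
qed

text \<open>\<open>Y\<close> will be another tile or a side of the polygon. By convexity the segment
  from \<open>x\<close> to \<open>y\<close> lies in both sets, and it avoids the interior of
  \<open>S\<close>, so it runs along the boundary.\<close>

lemma two_points_common_edge:
  assumes "S = convex hull {a, b, c :: complex}" "convex Y" "Y \<inter> interior S = {}"
    and "x \<in> S \<inter> Y" "y \<in> S \<inter> Y" "x \<noteq> y"
  shows "kap (x - y) \<in> {kap (a - b), kap (b - c), kap (c - a)}"
proof (rule triangle_edge_parallel[OF _ assms(6)])
  have "closed_segment x y \<subseteq> S" "closed_segment x y \<subseteq> Y"
    using assms(2,4,5) by (simp_all add: assms(1) closed_segment_subset)
  then show "closed_segment x y \<subseteq> frontier (convex hull {a, b, c})"
    using assms(3) closure_subset[of S] unfolding frontier_def assms(1) by blast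
qed

text \<open>The right angle makes \<open>a - c\<close> a real multiple of
  \<open>\<i> * (b - c)\<close>, the angle at \<open>b\<close> fixes the multiple up to sign, and
  the orientation fixes the sign. In this linear form the shape of a tile can be passed through
  \<open>G\<close>.\<close>

lemma right_triangle_legs:
  assumes nc: "\<not> collinear {a, b, c}" and C: "angle_at a c b = pi / 2"
    and B: "angle_at a b c = \<beta>" "0 < \<beta>" "\<beta> < pi / 2"
  shows "a - c = - of_real (orient a b c) * \<i> * of_real (tan \<beta>) * (b - c)"
proof -
  define s where "s = b - c"
  have ne: "a \<noteq> b" "b \<noteq> c" "a \<noteq> c" using nc by (auto simp: insert_commute)
  have s0: "s \<noteq> 0" using ne by (simp add: s_def)
  have cs: "- 1 \<le> (x \<bullet> y) / (cmod x * cmod y) \<and> (x \<bullet> y) / (cmod x * cmod y) \<le> 1" for x y :: complex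
  proof -
    have "\<bar>(x \<bullet> y) / (cmod x * cmod y)\<bar> \<le> 1"
      using Cauchy_Schwarz_ineq2[of x y] by (cases "x = 0 \<or> y = 0") (auto simp: abs_divide abs_mult)
    then show ?thesis by linarith
  qed
  have cosang: "cos (angle_at p q r) = ((p - q) \<bullet> (r - q)) / (cmod (p - q) * cmod (r - q))" for p q r
    unfolding angle_at_def using cs[of "p - q" "r - q"] by (intro cos_arccos) auto
  have "(a - c) \<bullet> s = 0"
    using cosang[of a c b] ne unfolding C by (simp add: s_def)
  define r where "r = Im (cnj s * (a - c)) / (cmod s)\<^sup>2"
  have "cnj s * (a - c) = \<i> * of_real (r * (cmod s)\<^sup>2)"
  proof -
    have "Re (cnj s * (a - c)) = 0"
      using \<open>(a - c) \<bullet> s = 0\<close> by (simp add: inner_complex_def algebra_simps)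
    moreover have "Im (cnj s * (a - c)) = r * (cmod s)\<^sup>2" using s0 by (simp add: r_def)
    ultimately show ?thesis unfolding complex_eq_iff by simp
  qed
  also have "\<dots> = cnj s * (\<i> * of_real r * s)"
    by (simp only: of_real_mult complex_norm_square) simp
  finally have ac: "a - c = \<i> * of_real r * s" using s0 by simp
  have ab: "a - b = s * (\<i> * of_real r - 1)" using ac by (simp add: s_def algebra_simps)
  have "(a - b) \<bullet> (c - b) = (cmod s)\<^sup>2"
  proof -
    have cb: "c - b = - s" by (simp add: s_def)
    show ?thesis unfolding ab cb cmod_power2
      by (simp add: inner_complex_def algebra_simps power2_eq_square)
  qed
  moreover have "cmod (a - b) = cmod s * sqrt (1 + r\<^sup>2)"
    unfolding ab norm_mult by (simp add: cmod_def add.commute)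
  moreover have "cmod (c - b) = cmod s" by (simp add: s_def norm_minus_commute)
  ultimately have "cos \<beta> = 1 / sqrt (1 + r\<^sup>2)"
    using cosang[of a b c] s0 unfolding B(1) by (simp add: power2_eq_square)
  moreover have p1: "1 + r\<^sup>2 > 0" by (simp add: add_pos_nonneg)
  ultimately have cos2: "(cos \<beta>)\<^sup>2 * (1 + r\<^sup>2) = 1" by (simp add: power_divide)
  have cpos: "cos \<beta> > 0" "tan \<beta> > 0" using B by (auto intro: cos_gt_zero tan_gt_zero)
  have "(cos \<beta>)\<^sup>2 * (1 + (tan \<beta>)\<^sup>2) = 1"
    using cpos(1) by (simp add: tan_def power_divide distrib_left)
  then have "r\<^sup>2 = (tan \<beta>)\<^sup>2" using cos2 cpos(1)
    by (metis add_left_cancel mult_cancel_left power_not_zero less_irrefl)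
  then have rt: "r = tan \<beta> \<or> r = - tan \<beta>" by (simp add: power2_eq_iff)
  have "orient a b c = - sgn r"
  proof -
    have "orient a b c = - orient c b a" using orient_cyclic[of a b c] orient_swap[of c b a] by simp
    moreover have "Im (cnj (b - c) * (a - c)) = r * (cmod s)\<^sup>2"
      unfolding s_def[symmetric] using s0 by (simp add: r_def)
    ultimately show ?thesis using s0 by (simp add: orient_def sgn_mult)
  qed
  then have "r = - orient a b c * tan \<beta>" using rt cpos(2) by auto
  then show ?thesis unfolding ac s_def[symmetric] by simp
qed

text \<open>These are the values of \<open>kap\<close> on edges, up to the factor
  \<open>kap (inverse w)\<close>. Both signs occur, because turning an edge by a right angle negates
  \<open>kap\<close>.\<close>

definition units :: "complex \<Rightarrow> complex set" where
  "units \<zeta> = {u. \<exists>k::nat. u = \<zeta> ^ k \<or> u = - (\<zeta> ^ k)}"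

lemma units_mult: "u \<in> units \<zeta> \<Longrightarrow> v \<in> units \<zeta> \<Longrightarrow> u * v \<in> units \<zeta>"
  unfolding units_def by (auto simp flip: power_add) 

lemma units_uminus: "u \<in> units \<zeta> \<Longrightarrow> - u \<in> units \<zeta>"
  unfolding units_def by auto

lemma units_uminus_iff: "- u \<in> units \<zeta> \<longleftrightarrow> u \<in> units \<zeta>"
  using units_uminus[of u \<zeta>] units_uminus[of "- u" \<zeta>] by auto

lemma units_power: "\<zeta> ^ k \<in> units \<zeta>"
  unfolding units_def by auto

lemma kap_hypotenuse:
  assumes "cos \<beta> \<noteq> 0" "e = 1 \<or> e = - 1"
  shows "kap (of_real e * \<i> * of_real (tan \<beta>) - 1) = cis (2 * e * \<beta>)"
proof -
  have eq: "of_real e * \<i> * of_real (tan \<beta>) - 1 = of_real (- 1 / cos \<beta>) * cis (- e * \<beta>)"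
    using assms by (auto simp: complex_eq_iff tan_def)
  have "kap (of_real (- 1 / cos \<beta>) * cis (- e * \<beta>)) = kap (cis (- e * \<beta>))"
    using kap_scaleR[of "- 1 / cos \<beta>" "cis (- e * \<beta>)"] assms(1) by (simp only: scaleR_conv_of_real) simp
  also have "\<dots> = cis (e * \<beta>) / cis (- e * \<beta>)" by (simp add: kap_def cis_cnj)
  also have "\<dots> = cis (2 * e * \<beta>)" by (simp add: cis_divide algebra_simps)
  finally show ?thesis unfolding eq .
qed

context right_triangle_tiling
begin

lemma orient_cases: "S \<in> T \<Longrightarrow> orient (A S) (B S) (C S) = 1 \<or> orient (A S) (B S) (C S) = - 1"
  using nondegenerate[of S] unfolding collinear_complex_iff orient_def sgn_real_def by presburger

lemma legs:
  assumes "S \<in> T" "\<alpha> = pi / 2 - \<beta>" "0 < \<beta>" "\<beta> < pi / 2"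
  shows "A S - C S = - of_real (orient (A S) (B S) (C S)) * \<i> * of_real (tan \<beta>) * (B S - C S)"
  using assms angle_B[OF assms(1)]
  by (intro right_triangle_legs[OF nondegenerate[OF assms(1)] angle_C[OF assms(1)]]) auto

text \<open>The legs differ in \<open>kap\<close> by the factor -1, and the hypotenuse differs from
  a leg by \<open>cis (2 * \<beta>)\<close> or its inverse. As \<beta> is exactly
  \<open>2 * pi / n\<close>, these factors are units, so the three edges of a tile stand or fall
  together.\<close>

lemma edge_units_iff:
  assumes S: "S \<in> T" and \<alpha>: "\<alpha> = pi / 2 - 2 * pi / real n" and n: "n \<ge> 5"
    and d: "k \<in> {kap (A S - B S), kap (B S - C S), kap (C S - A S)}"
  defines "\<zeta> \<equiv> cis (2 * pi / real n)"
  shows "k * u \<in> units \<zeta> \<longleftrightarrow> kap (B S - C S) * u \<in> units \<zeta>"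
proof -
  define \<beta> where "\<beta> = 2 * pi / real n"
  have \<beta>: "0 < \<beta>" "\<beta> < pi / 2" using n by (auto simp: \<beta>_def field_simps)
  define e where "e = - orient (A S) (B S) (C S)"
  have e: "e = 1 \<or> e = - 1" using orient_cases[OF S] by (auto simp: e_def)
  have cpos: "cos \<beta> \<noteq> 0" "tan \<beta> \<noteq> 0" using cos_gt_zero[of \<beta>] tan_gt_zero[of \<beta>] \<beta> by auto
  have ac: "A S - C S = (of_real e * \<i> * of_real (tan \<beta>)) * (B S - C S)"
    using legs[OF S _ \<beta>] \<alpha> by (simp add: e_def \<beta>_def)
  then have ab: "A S - B S = (of_real e * \<i> * of_real (tan \<beta>) - 1) * (B S - C S)"
    by (simp add: algebra_simps)
  have "kap (of_real e * \<i> * of_real (tan \<beta>)) = - 1"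
    using e cpos by (auto simp: kap_def)
  then have 1: "kap (C S - A S) = - kap (B S - C S)"
    unfolding kap_minus_commute[of "C S"] ac kap_mult by simp
  have 2: "kap (A S - B S) = cis (2 * e * \<beta>) * kap (B S - C S)"
    unfolding ab kap_mult kap_hypotenuse[OF cpos(1) e] ..
  have cu: "cis (2 * \<beta>) \<in> units \<zeta>" "cis (- 2 * \<beta>) \<in> units \<zeta>"
  proof -
    have "cis (2 * \<beta>) = \<zeta> ^ 2" by (simp add: \<zeta>_def \<beta>_def Complex.DeMoivre)
    then show "cis (2 * \<beta>) \<in> units \<zeta>" by (simp add: units_power)
    \<comment> \<open>Exponents in \<open>units\<close> are natural numbers, so the inverse of
      \<open>\<zeta> ^ 2\<close> appears as \<open>\<zeta> ^ (n - 2)\<close>.\<close>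
    have "\<zeta> ^ (n - 2) = cis (real (n - 2) * \<beta>)"
      by (simp add: \<zeta>_def \<beta>_def Complex.DeMoivre)
    also have "real (n - 2) * \<beta> = real n * \<beta> + - 2 * \<beta>"
      using n by (simp add: of_nat_diff algebra_simps)
    also have "cis (real n * \<beta> + - 2 * \<beta>) = cis (real n * \<beta>) * cis (- 2 * \<beta>)" by (rule cis_mult[symmetric])
    also have "\<dots> = cis (- 2 * \<beta>)" using n by (simp add: \<beta>_def)
    finally show "cis (- 2 * \<beta>) \<in> units \<zeta>" by (metis units_power)
  qed
  then have cu': "cis (2 * e * \<beta>) \<in> units \<zeta>" "cis (- 2 * e * \<beta>) \<in> units \<zeta>"
    using e by auto
  have "cis (- 2 * e * \<beta>) * cis (2 * e * \<beta>) = 1" by (simp add: cis_mult)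
  then have "kap (B S - C S) * u = cis (- 2 * e * \<beta>) * (kap (A S - B S) * u)"
    unfolding 2 by (simp add: mult.assoc[symmetric])
  then have "kap (A S - B S) * u \<in> units \<zeta> \<longleftrightarrow> kap (B S - C S) * u \<in> units \<zeta>"
    using units_mult[OF cu'(1), of "kap (B S - C S) * u"] units_mult[OF cu'(2), of "kap (A S - B S) * u"]
    unfolding 2 mult.assoc by metis
  then show ?thesis using d 1 by (auto simp: units_uminus_iff)
qed

text \<open>The property propagates from a side of the polygon: tiles with two common points have parallel edges,
  and the interior of the polygon stays connected when finitely many points are removed.\<close>

lemma all_edges_units:
  assumes \<alpha>: "\<alpha> = pi / 2 - 2 * pi / real n" and n: "n \<ge> 5" and w: "w \<noteq> 0"
    and P: "P = convex hull (range (ngon_vertex n z w))"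
    and S: "S \<in> T" and k: "k \<in> {kap (A S - B S), kap (B S - C S), kap (C S - A S)}"
  defines "\<zeta> \<equiv> cis (2 * pi / real n)"
  shows "k * kap (inverse w) \<in> units \<zeta>"
proof -
  define good where "good S \<longleftrightarrow> kap (B S - C S) * kap (inverse w) \<in> units \<zeta>" for S
  have good_iff: "k * kap (inverse w) \<in> units \<zeta> \<longleftrightarrow> good S"
    if "S \<in> T" "k \<in> {kap (A S - B S), kap (B S - C S), kap (C S - A S)}" for S k
    unfolding good_def \<zeta>_def by (rule edge_units_iff[OF that(1) \<alpha> n that(2)])
  have share: "good S \<longleftrightarrow> good S'"
    if "S \<in> T" "S' \<in> T" "S \<noteq> S'" "x \<in> S \<inter> S'" "y \<in> S \<inter> S'" "x \<noteq> y" for S S' x y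
  proof -
    have 1: "kap (x - y) \<in> {kap (A S - B S), kap (B S - C S), kap (C S - A S)}"
      using that interiors_disjoint[of S S']
        convex_disjoint_interior[of S' S, OF convex_tile closed_tile interior_tile]
      by (intro two_points_common_edge[OF tile_eq convex_tile[of S']]) auto
    have 2: "kap (x - y) \<in> {kap (A S' - B S'), kap (B S' - C S'), kap (C S' - A S')}"
      using that interiors_disjoint[of S S']
        convex_disjoint_interior[of S S', OF convex_tile closed_tile interior_tile]
      by (intro two_points_common_edge[OF tile_eq convex_tile[of S]]) auto
    show ?thesis using good_iff[OF that(1) 1] good_iff[OF that(2) 2] by blast
  qed
  have n3: "n \<ge> 3" using n by simp
  obtain S0 where S0: "S0 \<in> T" "good S0"
  proof -
    define v where "v = ngon_vertex n z w"
    have d: "v 1 - v 0 = w * (\<zeta> - 1)" by (simp add: v_def ngon_vertex_def \<zeta>_def algebra_simps)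
    have "\<zeta> \<noteq> 1"
    proof
      assume "\<zeta> = 1"
      then have "sin (2 * pi / real n) = 0" by (simp add: \<zeta>_def complex_eq_iff)
      moreover have "sin (2 * pi / real n) > 0" using n by (intro sin_gt_zero) (auto simp: field_simps)
      ultimately show False by simp
    qed
    then have ne: "v 1 \<noteq> v 0" using d w by auto
    have "v k \<in> P" for k unfolding P v_def by (intro hull_inc) auto
    then have sub: "closed_segment (v 1) (v 0) \<subseteq> P" by (simp add: P closed_segment_subset)
    then have "closed_segment (v 1) (v 0) = (\<Union>S\<in>T. S \<inter> closed_segment (v 1) (v 0))"
      using Union_tiles by blast
    moreover have "infinite (closed_segment (v 1) (v 0))" using ne by simp
    \<comment> \<open>Finitely many tiles cover the side, so one of them contains infinitely many of
      its points and has an edge parallel to it.\<close>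
    ultimately obtain S where S: "S \<in> T" "infinite (S \<inter> closed_segment (v 1) (v 0))"
      using finite_tiles by (metis finite_UN)
    obtain x where x: "x \<in> S \<inter> closed_segment (v 1) (v 0)" using infinite_imp_nonempty[OF S(2)] by blast
    have "infinite (S \<inter> closed_segment (v 1) (v 0) - {x})" using S(2) by simp
    then obtain y where y: "y \<in> S \<inter> closed_segment (v 1) (v 0) - {x}" using infinite_imp_nonempty by blast
    have "closed_segment (v 1) (v 0) \<inter> interior S = {}"
    proof -
      have "p \<notin> interior P" if p: "p \<in> closed_segment (v 1) (v 0)" for p
      proof (rule boundary_halfplane_not_interior[of P "v 1 - v 0" "v 0"])
        show "Im (cnj (v 1 - v 0) * (x - v 0)) \<ge> 0" if "x \<in> P" for x
          using ngon_corner(5)[OF n3 w, of x z 0] that unfolding P v_def by simp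
        obtain t where t: "p = (1 - t) *\<^sub>R v 1 + t *\<^sub>R v 0" using p by (auto simp: in_segment)
        have "p - v 0 = of_real (1 - t) * (v 1 - v 0)" unfolding t by (simp add: scaleR_conv_of_real algebra_simps)
        then have "cnj (v 1 - v 0) * (p - v 0) = of_real (1 - t) * ((v 1 - v 0) * cnj (v 1 - v 0))" by simp
        then show "Im (cnj (v 1 - v 0) * (p - v 0)) = 0" unfolding complex_norm_square[symmetric] by simp
      qed (use ne in simp)
      moreover have "interior S \<subseteq> interior P" using S(1) Union_tiles by (intro interior_mono) auto
      ultimately show ?thesis by blast
    qed
    then have 1: "kap (x - y) \<in> {kap (A S - B S), kap (B S - C S), kap (C S - A S)}"
      using x y by (intro two_points_common_edge[OF tile_eq[OF S(1)], of "closed_segment (v 1) (v 0)"]) auto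
    have "kap (x - y) = kap (v 1 - v 0)" using x y by (intro kap_closed_segment) auto
    also have "\<dots> * kap (inverse w) = kap (\<zeta> - 1)"
    proof -
      have *: "w * (\<zeta> - 1) * inverse w = \<zeta> - 1" using w by simp
      show ?thesis unfolding d kap_mult[symmetric] * ..
    qed
    also have "kap (\<zeta> - 1) = - (\<zeta> ^ (n - 1))"
    proof -
      have "\<zeta> ^ n = 1" using n by (simp add: \<zeta>_def Complex.DeMoivre)
      then have "\<zeta> ^ (n - 1) * \<zeta> = 1" using n by (simp flip: power_Suc2)
      moreover have "cnj \<zeta> * \<zeta> = 1" by (simp add: \<zeta>_def cis_cnj cis_mult)
      ultimately have "\<zeta> ^ (n - 1) = cnj \<zeta>" by (metis mult_right_cancel mult_zero_right zero_neq_one)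
      moreover have "cnj (\<zeta> - 1) = - cnj \<zeta> * (\<zeta> - 1)" using \<open>cnj \<zeta> * \<zeta> = 1\<close> by (simp add: algebra_simps)
      ultimately show ?thesis using \<open>\<zeta> \<noteq> 1\<close> by (simp add: kap_def)
    qed
    finally have "kap (x - y) * kap (inverse w) \<in> units \<zeta>" by (simp add: units_uminus_iff units_power)
    then show ?thesis using good_iff[OF S(1) 1] S(1) that by blast
  qed
  have "good S" if "S \<in> T" for S
  proof (rule ccontr)
    assume bad: "\<not> good S"
    \<comment> \<open>By \<open>share\<close>, a good and a bad tile have at most one common point,
      so \<open>F\<close> is finite.\<close>
    define F where "F = (\<Union>S\<in>{S \<in> T. good S}. \<Union>S'\<in>{S \<in> T. \<not> good S}. S \<inter> S')"
    have "finite (S \<inter> S')" if "S \<in> T" "good S" "S' \<in> T" "\<not> good S'" for S S'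
    proof (rule ccontr)
      assume inf: "infinite (S \<inter> S')"
      obtain x where x: "x \<in> S \<inter> S'" using infinite_imp_nonempty[OF inf] by blast
      have "infinite (S \<inter> S' - {x})" using inf by simp
      then obtain y where "y \<in> S \<inter> S' - {x}" using infinite_imp_nonempty by blast
      then show False using share[of S S' x y] x that by blast
    qed
    then have "finite F" unfolding F_def using finite_tiles by (intro finite_UN_I) simp_all
    define U where "U = interior P - F"
    have "connected (interior P)" unfolding P by (simp add: convex_connected)
    then have U: "connected U" unfolding U_def
      using \<open>finite F\<close> by (intro connected_open_delete_finite) auto
    have meets: "U \<inter> S \<noteq> {}" if "S \<in> T" for S
    proof -
      have "infinite (interior S)" using interior_tile[OF that] finite_imp_not_open open_interior by blast
      then have "infinite (interior S - F)" using \<open>finite F\<close> by simp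
      then have "interior S - F \<noteq> {}" by (rule infinite_imp_nonempty)
      moreover have "interior S \<subseteq> interior P" using that Union_tiles by (intro interior_mono) auto
      ultimately show ?thesis unfolding U_def using interior_subset by blast
    qed
    \<comment> \<open>Away from \<open>F\<close>, the good and the bad tiles would split the
      connected set \<open>U\<close> into two nonempty relatively closed pieces.\<close>
    have "closed (\<Union>{S \<in> T. good S})" "closed (\<Union>{S \<in> T. \<not> good S})"
      using finite_tiles closed_tile by (auto intro!: closed_Union)
    moreover have "U \<subseteq> \<Union>{S \<in> T. good S} \<union> \<Union>{S \<in> T. \<not> good S}"
    proof -
      have "U \<subseteq> \<Union>T" unfolding U_def Union_tiles using interior_subset by blast
      then show ?thesis by blast
    qed
    moreover have "\<Union>{S \<in> T. good S} \<inter> \<Union>{S \<in> T. \<not> good S} \<inter> U = {}"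
      unfolding U_def F_def by blast
    moreover have "\<Union>{S \<in> T. good S} \<inter> U \<noteq> {}" using meets[OF S0(1)] S0 by blast
    moreover have "\<Union>{S \<in> T. \<not> good S} \<inter> U \<noteq> {}" using meets[OF that] that bad by blast
    ultimately show False using U unfolding connected_closed by blast
  qed
  then show ?thesis using good_iff[OF S k] S by blast
qed

end

section \<open>The area obstruction for pentagon and heptagon\<close>

context right_triangle_tiling
begin

text \<open>Transport of the area formula \<open>\<Sum> twist(v) * v\<^sup>2\<close> by the semilinear map \<open>G\<close>: the image of each tile
  has signed area of the sign of \<open>tan (j * \<beta>)\<close>, the image of the polygon that of \<open>sin (j * \<beta>)\<close>, and
  \<open>cos (j * \<beta>) < 0\<close>.\<close>

lemma no_pentagon_heptagon:
  assumes n: "n \<in> {5, 7}" and \<alpha>: "\<alpha> = pi / 2 - 2 * pi / real n" and w: "w \<noteq> 0"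
    and P: "P = convex hull (range (ngon_vertex n z w))"
  shows False
proof -
  have n5: "n \<ge> 5" and n3: "n \<ge> 3" using n by auto
  define \<beta> where "\<beta> = 2 * pi / real n"
  define \<zeta> where "\<zeta> = cis \<beta>"
  have \<beta>: "0 < \<beta>" "\<beta> < pi / 2" using n by (auto simp: \<beta>_def)
  have cos\<beta>: "cos \<beta> > 0" using \<beta> by (intro cos_gt_zero) auto
  have \<zeta>': "\<zeta> = cis (2 * pi / real n)" by (simp add: \<zeta>_def \<beta>_def)
  obtain G :: "complex \<Rightarrow> complex" and j :: nat where j: "2 \<le> j" "j \<le> n - 2"
    and Gadd: "\<And>x y. G (x + y) = G x + G y" and G\<zeta>: "\<And>x. G (\<zeta> * x) = \<zeta> ^ j * G x"
    and Gi: "\<And>x. G (\<i> * x) = \<i> * G x" and Gc: "\<And>x. G (cnj x) = cnj (G x)" and G1: "G 1 = 1"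
    by (rule semilinear_map[OF n3 cos_pentagon_heptagon_irrational[OF n], folded \<zeta>']; rule that; assumption)
  define \<omega> where "\<omega> = \<zeta> ^ j"
  define \<theta> where "\<theta> = real j * \<beta>"
  have \<omega>: "\<omega> = cis \<theta>" by (simp add: \<omega>_def \<zeta>_def \<theta>_def Complex.DeMoivre)
  have cos_neg: "cos \<theta> < 0" and sin_ne: "sin \<theta> \<noteq> 0"
  proof -
    \<comment> \<open>For these two \<open>n\<close>, every \<open>j\<close> from 2 to
      \<open>n - 2\<close> lies strictly between \<open>n / 4\<close> and \<open>3 * n / 4\<close>,
      and \<open>n\<close> is odd.\<close>
    have "2 * n < 8 * j" "8 * j < 6 * n" "2 * j \<noteq> n"
      using n j by (auto, presburger+)
    then have "real (2 * n) < real (8 * j)" "real (8 * j) < real (6 * n)" "real (2 * j) \<noteq> real n"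
      by (simp_all only: of_nat_less_iff of_nat_eq_iff) simp_all
    then have r: "2 * real n < 8 * real j" "8 * real j < 6 * real n" "2 * real j \<noteq> real n"
      by simp_all
    have \<theta>eq: "\<theta> = pi * (2 * real j / real n)" by (simp add: \<theta>_def \<beta>_def)
    have q: "1 / 2 < 2 * real j / real n" "2 * real j / real n < 3 / 2" "2 * real j / real n \<noteq> 1"
      using r n5 by (auto simp: field_simps)
    have "pi * (1 / 2) < \<theta>" "\<theta> < pi * (3 / 2)" unfolding \<theta>eq
      by (rule mult_strict_left_mono[OF _ pi_gt_zero], rule q)+
    then have "cos (\<theta> - pi) > 0" by (intro cos_gt_zero_pi) auto
    then show "cos \<theta> < 0" by (simp add: cos_diff)
    show "sin \<theta> \<noteq> 0"
    proof
      assume "sin \<theta> = 0"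
      then obtain i :: int where "\<theta> = of_int i * pi" using sin_zero_iff_int2 by blast
      then have "pi * (2 * real j / real n) = pi * of_int i" using \<theta>eq by (metis mult.commute)
      then have "2 * real j / real n = of_int i" by (metis mult_left_cancel pi_neq_zero)
      then have "1 / 2 < real_of_int i" "real_of_int i < 3 / 2" "i \<noteq> 1" using q by auto
      then have "0 < i" "i < 2" "i \<noteq> 1" by linarith+
      then show False by simp
    qed
  qed
  have G0: "G 0 = 0" using Gadd[of 0 0] by simp
  have Gm: "G (- x) = - G x" for x using Gadd[of x "- x"] G0 by (simp add: eq_neg_iff_add_eq_0 add.commute)
  have Gdiff: "G (x - y) = G x - G y" for x y using Gadd[of x "- y"] by (simp add: Gm)
  have Gsum: "finite X \<Longrightarrow> G (sum f X) = (\<Sum>x\<in>X. G (f x))" for f :: "'x \<Rightarrow> complex" and X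
    by (induction X rule: finite_induct) (simp_all add: G0 Gadd)
  have Gpow: "G (\<zeta> ^ k * x) = \<omega> ^ k * G x" for k x
    by (induction k) (simp_all add: G\<zeta> \<omega>_def mult.assoc)
  have Gc\<zeta>: "G (cnj \<zeta> * x) = cnj \<omega> * G x" for x
  proof -
    have "G (cnj \<zeta> * x) = G (cnj (\<zeta> * cnj x))" by simp
    also have "\<dots> = cnj \<omega> * G x" unfolding Gc G\<zeta> \<omega>_def by (simp add: Gc)
    finally show ?thesis .
  qed
  have Gcpow: "G (cnj \<zeta> ^ k * x) = cnj \<omega> ^ k * G x" for k x
    by (induction k) (simp_all add: Gc\<zeta> mult.assoc)
  \<comment> \<open>\<open>G\<close> is not assumed multiplicative; factors from
    \<open>units\<close> nevertheless pass through it.\<close>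
  have Gunits: "G (u * x) = G u * G x" if "u \<in> units \<zeta>" for u x
    using that Gpow[of _ x] Gpow[of _ 1] unfolding units_def by (auto simp: Gm G1)
  \<comment> \<open>Dividing by \<open>w\<close> moves the vertices of the polygon to the powers of
    \<zeta>, which \<open>g\<close> then sends to the powers of \<omega>. Correspondingly
    \<open>\<kappa> * kap d = kap (d / w)\<close>.\<close>
  define \<kappa> where "\<kappa> = kap (inverse w)"
  define g where "g v = G ((v - z) / w)" for v
  have gdiff: "g u - g v = G ((u - v) / w)" for u v
    unfolding g_def Gdiff[symmetric] by (simp add: diff_divide_distrib)
  define \<Phi> where "\<Phi> X v = G (\<kappa> * local_twist X v)" for X v
  define v where "v k = ngon_vertex n z w (int k)" for k
  define V where "V = A ` T \<union> B ` T \<union> C ` T \<union> v ` {..<n}"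
  have finV: "finite V" unfolding V_def using finite_tiles by simp
  \<comment> \<open>This is the image under \<open>G\<close> of \<open>kap d * d = cnj d\<close>; it
    needs the normalised \<open>kap\<close> of an edge to be a unit.\<close>
  have edge: "G (\<kappa> * kap (x - y)) * (g x - g y) = cnj (g x - g y)"
    if "S \<in> T" "kap (x - y) \<in> {kap (A S - B S), kap (B S - C S), kap (C S - A S)}" for S x y
  proof -
    have u: "kap (x - y) * \<kappa> \<in> units \<zeta>"
      using all_edges_units[OF \<alpha> n5 w P that] unfolding \<kappa>_def \<zeta>' .
    have "kap (x - y) * \<kappa> * ((x - y) / w) = cnj ((x - y) / w)"
      using w by (cases "x = y") (simp_all add: \<kappa>_def kap_def field_simps)
    then have "G (kap (x - y) * \<kappa>) * G ((x - y) / w) = cnj (G ((x - y) / w))"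
      by (metis Gunits[OF u] Gc)
    then show ?thesis unfolding gdiff by (simp add: mult.commute)
  qed
  have tile: "of_real (cos \<theta>) * (\<Sum>x\<in>V. \<Phi> S x * (g x)\<^sup>2) =
      - 2 * \<i> * of_real (sin \<theta>) * of_real ((cmod (g (B S) - g (C S)))\<^sup>2)" if S: "S \<in> T" for S
  proof -
    define o' where "o' = complex_of_real (orient (A S) (B S) (C S))"
    have o: "o' = 1 \<or> o' = - 1" using orient_cases[OF S] by (auto simp: o'_def)
    define p where "p = g (B S) - g (C S)"
    define q where "q = g (A S) - g (C S)"
    define c where "c = g (C S)"
    have abc: "g (A S) = c + q" "g (B S) = c + p" "g (C S) = c" by (simp_all add: p_def q_def c_def)
    have sub: "{A S, B S, C S} \<subseteq> V" using S unfolding V_def by auto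
    have "(\<Sum>x\<in>V. \<Phi> S x * (g x)\<^sup>2) = (\<Sum>x\<in>{A S, B S, C S}. \<Phi> S x * (g x)\<^sup>2)"
      using tile_at_other(3)[OF S] by (intro sum.mono_neutral_right finV sub) (auto simp: \<Phi>_def G0)
    also have "\<dots> = \<Phi> S (A S) * (c + q)\<^sup>2 + \<Phi> S (B S) * (c + p)\<^sup>2 + \<Phi> S (C S) * c\<^sup>2"
      using vertices_distinct[OF S] by (simp add: abc)
    finally have 1: "(\<Sum>x\<in>V. \<Phi> S x * (g x)\<^sup>2) =
      \<Phi> S (A S) * (c + q)\<^sup>2 + \<Phi> S (B S) * (c + p)\<^sup>2 + \<Phi> S (C S) * c\<^sup>2" .
    define k1 where "k1 = G (\<kappa> * kap (A S - B S))"
    define k2 where "k2 = G (\<kappa> * kap (B S - C S))"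
    define k3 where "k3 = G (\<kappa> * kap (A S - C S))"
    have Go: "G (\<kappa> * (o' * (x - y))) = o' * (G (\<kappa> * x) - G (\<kappa> * y))" for x y
      using o by (auto simp: right_diff_distrib Gdiff Gm)
    have tw: "\<Phi> S (A S) = o' * (k3 - k1)" "\<Phi> S (B S) = o' * (k1 - k2)" "\<Phi> S (C S) = o' * (k2 - k3)"
      unfolding \<Phi>_def tile_at_vertex(7-9)[OF S] o'_def[symmetric] Go k1_def k2_def k3_def
        kap_minus_commute[of "C S"] kap_minus_commute[of "B S" "A S"] by simp_all
    have e: "k1 * (q - p) = cnj (q - p)" "k2 * p = cnj p" "k3 * q = cnj q"
      using edge[OF S, of "A S" "B S"] edge[OF S, of "B S" "C S"] edge[OF S, of "A S" "C S"]
      unfolding kap_minus_commute[of "C S" "A S"] k1_def k2_def k3_def p_def q_def by simp_all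
    \<comment> \<open>Regrouping by edges leaves differences of squares, each with a factor on which
      \<open>edge\<close> acts; the terms with \<open>c\<close> cancel, leaving a cross
      product.\<close>
    have "(\<Sum>x\<in>V. \<Phi> S x * (g x)\<^sup>2) = o' * (k3 * q * (2 * c + q) - k1 * (q - p) * (2 * c + q + p) - k2 * p * (2 * c + p))"
      unfolding 1 tw by (simp add: power2_eq_square algebra_simps)
    also have "\<dots> = o' * (cnj p * q - cnj q * p)"
      unfolding e by (simp add: algebra_simps)
    finally have 2: "(\<Sum>x\<in>V. \<Phi> S x * (g x)\<^sup>2) = o' * (cnj p * q - cnj q * p)" .
    have qp: "of_real (cos \<theta>) * q = - o' * \<i> * of_real (sin \<theta>) * p"
    proof -
      define a where "a = (A S - C S) / w"
      define b where "b = (B S - C S) / w"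
      have "A S - C S = - o' * \<i> * of_real (tan \<beta>) * (B S - C S)"
        using legs[OF S _ \<beta>] \<alpha> by (simp add: \<beta>_def o'_def)
      then have *: "of_real (cos \<beta>) * a = - o' * \<i> * of_real (sin \<beta>) * b"
        using cos\<beta> by (simp add: a_def b_def tan_def)
      \<comment> \<open>Real factors such as \<open>tan \<beta>\<close> do not pass through
        \<open>G\<close>. The leg relation is therefore rewritten with coefficients
        \<open>\<zeta> + cnj \<zeta>\<close> and \<open>\<zeta> - cnj \<zeta>\<close>, which
        \<open>G\<close> turns into those of \<omega>.\<close>
      have cs: "\<zeta> + cnj \<zeta> = 2 * of_real (cos \<beta>)" "\<zeta> - cnj \<zeta> = 2 * \<i> * of_real (sin \<beta>)"
        by (simp_all add: \<zeta>_def complex_eq_iff)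
      have "(\<zeta> + cnj \<zeta>) * a = 2 * (of_real (cos \<beta>) * a)" unfolding cs by simp
      also have "\<dots> = - o' * ((\<zeta> - cnj \<zeta>) * b)" unfolding cs * by simp
      finally have "(\<zeta> + cnj \<zeta>) * a = - o' * ((\<zeta> - cnj \<zeta>) * b)" .
      then have "G ((\<zeta> + cnj \<zeta>) * a) = - o' * G ((\<zeta> - cnj \<zeta>) * b)"
        using o by (auto simp: Gm)
      then have "(\<omega> + cnj \<omega>) * G a = - o' * ((\<omega> - cnj \<omega>) * G b)"
        by (simp add: distrib_right left_diff_distrib Gadd Gdiff G\<zeta> Gc\<zeta> flip: \<omega>_def)
      moreover have cs': "\<omega> + cnj \<omega> = 2 * of_real (cos \<theta>)" "\<omega> - cnj \<omega> = 2 * \<i> * of_real (sin \<theta>)"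
        by (simp_all add: \<omega> complex_eq_iff)
      moreover have "G a = q" "G b = p" unfolding q_def p_def gdiff a_def b_def by simp_all
      ultimately have "2 * of_real (cos \<theta>) * q = - o' * (2 * \<i> * of_real (sin \<theta>) * p)" by (simp only:)
      then show ?thesis by (simp add: mult_ac)
    qed
    then have "cnj (of_real (cos \<theta>) * q) = cnj (- o' * \<i> * of_real (sin \<theta>) * p)" by simp
    then have qp': "of_real (cos \<theta>) * cnj q = o' * \<i> * of_real (sin \<theta>) * cnj p" using o by auto
    have "of_real (cos \<theta>) * (o' * (cnj p * q - cnj q * p)) =
      o' * (cnj p * (of_real (cos \<theta>) * q) - (of_real (cos \<theta>) * cnj q) * p)" by (simp add: algebra_simps)
    also have "\<dots> = - 2 * (o' * o') * \<i> * of_real (sin \<theta>) * (p * cnj p)"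
      unfolding qp qp' by (simp add: algebra_simps)
    \<comment> \<open>The orientation enters through both the twist and the leg relation, so tiles
      of either orientation contribute with the same sign.\<close>
    also have "o' * o' = 1" using o by auto
    finally show ?thesis unfolding 2 p_def[symmetric] complex_norm_square by simp
  qed
  have polygon: "(\<Sum>x\<in>V. \<Phi> P x * (g x)\<^sup>2) = - 2 * \<i> * of_real (sin \<theta>) * of_nat n"
  proof -
    have range: "range (ngon_vertex n z w) = v ` {..<n}"
      using range_ngon_vertex[of n z w] n5 by (simp add: v_def ngon_vertex_def)
    have closedP: "closed P" unfolding P range
      by (intro compact_imp_closed finite_imp_compact_convex_hull) simp
    have zero: "local_twist P x = 0" if "x \<notin> v ` {..<n}" for x
    proof (cases "x \<in> P")
      case True
      then show ?thesis using ngon_other_points(2)[OF n3 w, of x z] that unfolding P range by blast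
    next
      case False
      then show ?thesis using local_int_outside[OF closedP] by (simp add: local_twist_def)
    qed
    have inj: "inj_on v {..<n}"
    proof (rule inj_onI)
      fix k l assume kl: "k \<in> {..<n}" "l \<in> {..<n}" "v k = v l"
      have "inj_on (\<lambda>k. cis (2 * pi * real k / real n)) {..<n}"
        using Complex.bij_betw_roots_unity[of n] n5 by (simp add: bij_betw_def)
      then show "k = l" using kl w by (auto simp: v_def ngon_vertex_def dest: inj_onD)
    qed
    have \<zeta>c: "\<zeta> * cnj \<zeta> = 1" by (simp add: \<zeta>_def cis_cnj cis_mult)
    have \<omega>c: "\<omega> * cnj \<omega> = 1" by (simp add: \<omega> cis_cnj cis_mult)
    have \<zeta>1: "\<zeta> \<noteq> 1" using \<beta> sin_gt_zero[of \<beta>] by (auto simp: \<zeta>_def complex_eq_iff)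
    have summand: "\<Phi> P (v k) * (g (v k))\<^sup>2 = - 2 * \<i> * of_real (sin \<theta>)" for k
    proof -
      have vk: "v k = z + w * \<zeta> ^ k"
        by (simp add: v_def ngon_vertex_def \<zeta>_def \<beta>_def Complex.DeMoivre mult.commute)
      have up: "ngon_vertex n z w (int k + 1) - v k = w * (\<zeta> ^ k * (\<zeta> - 1))"
        and dn: "ngon_vertex n z w (int k - 1) - v k = w * (\<zeta> ^ k * (cnj \<zeta> - 1))"
      proof -
        have *: "\<beta> * (real k + 1) = real k * \<beta> + \<beta>" "\<beta> * (real k - 1) = real k * \<beta> + - \<beta>"
          by (simp_all add: algebra_simps)
        have "cis (\<beta> * (real k + 1)) = \<zeta> ^ k * \<zeta>" "cis (\<beta> * (real k - 1)) = \<zeta> ^ k * cnj \<zeta>"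
          by (simp_all only: * \<zeta>_def Complex.DeMoivre cis_cnj cis_mult)
        moreover have "ngon_vertex n z w (int k + 1) = z + w * cis (\<beta> * (real k + 1))"
          "ngon_vertex n z w (int k - 1) = z + w * cis (\<beta> * (real k - 1))"
          by (simp_all only: ngon_vertex_def \<beta>_def of_int_add of_int_diff of_int_of_nat_eq of_int_1)
        ultimately show "ngon_vertex n z w (int k + 1) - v k = w * (\<zeta> ^ k * (\<zeta> - 1))"
          "ngon_vertex n z w (int k - 1) - v k = w * (\<zeta> ^ k * (cnj \<zeta> - 1))"
          unfolding vk by (simp_all only: add_diff_cancel_left right_diff_distrib mult_1_right)
      qed
      have "kap \<zeta> = (cnj \<zeta>)\<^sup>2"
        using \<zeta>c by (simp add: kap_def power2_eq_square field_simps \<zeta>_def)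
      then have kpow: "kap (\<zeta> ^ k) = cnj \<zeta> ^ (2 * k)"
        by (induction k) (simp_all add: kap_mult kap_def[of 1] power2_eq_square)
      have "cnj \<zeta> - 1 = - cnj \<zeta> * (\<zeta> - 1)" using \<zeta>c by (simp add: algebra_simps)
      then have k1: "kap (\<zeta> - 1) = - cnj \<zeta>" using \<zeta>1 by (simp add: kap_def)
      have "\<zeta> - 1 = - \<zeta> * (cnj \<zeta> - 1)" using \<zeta>c by (simp add: algebra_simps)
      moreover have "cnj \<zeta> - 1 \<noteq> 0" using \<zeta>1 by (metis complex_cnj_cnj complex_cnj_one right_minus_eq)
      ultimately have k2: "kap (cnj \<zeta> - 1) = - \<zeta>" by (simp add: kap_def)
      have ww: "\<kappa> * kap (w * x) = kap x" for x
        unfolding \<kappa>_def kap_mult[symmetric] using w by (simp add: mult.assoc[symmetric])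
      have tw: "local_twist P (v k) = kap (w * (\<zeta> ^ k * (cnj \<zeta> - 1))) - kap (w * (\<zeta> ^ k * (\<zeta> - 1)))"
        using ngon_corner(3)[OF n3 w, of z "int k"] unfolding P[symmetric] v_def[symmetric] up dn .
      have "\<kappa> * local_twist P (v k) = kap (\<zeta> ^ k * (cnj \<zeta> - 1)) - kap (\<zeta> ^ k * (\<zeta> - 1))"
        by (simp only: tw right_diff_distrib[of \<kappa>] ww)
      also have "\<dots> = cnj \<zeta> ^ (2 * k) * (cnj \<zeta> - \<zeta>)"
        unfolding kap_mult kpow k1 k2 by (simp add: algebra_simps)
      finally have "\<kappa> * local_twist P (v k) = cnj \<zeta> ^ (2 * k) * (cnj \<zeta> - \<zeta>)" .
      then have "\<Phi> P (v k) = cnj \<omega> ^ (2 * k) * (cnj \<omega> - \<omega>)"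
        unfolding \<Phi>_def using Gc\<zeta>[of 1] G\<zeta>[of 1] by (simp add: Gcpow Gdiff G1 \<omega>_def)
      moreover have "g (v k) = \<omega> ^ k"
        unfolding g_def vk using w Gpow[of k 1] by (simp add: G1)
      ultimately have "\<Phi> P (v k) * (g (v k))\<^sup>2 = (\<omega> * cnj \<omega>) ^ (2 * k) * (cnj \<omega> - \<omega>)"
        by (simp add: power_mult_distrib power_mult[symmetric] mult_ac)
      also have "\<dots> = - 2 * \<i> * of_real (sin \<theta>)" unfolding \<omega>c by (simp add: \<omega> complex_eq_iff)
      finally show ?thesis .
    qed
    have "(\<Sum>x\<in>V. \<Phi> P x * (g x)\<^sup>2) = (\<Sum>x\<in>v ` {..<n}. \<Phi> P x * (g x)\<^sup>2)"
      using zero by (intro sum.mono_neutral_right finV) (auto simp: V_def \<Phi>_def G0)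
    also have "\<dots> = (\<Sum>k<n. \<Phi> P (v k) * (g (v k))\<^sup>2)" by (simp add: sum.reindex[OF inj])
    also have "\<dots> = - 2 * \<i> * of_real (sin \<theta>) * of_nat n" unfolding summand by simp
    finally show ?thesis .
  qed
  have total: "(\<Sum>S\<in>T. \<Sum>x\<in>V. \<Phi> S x * (g x)\<^sup>2) = (\<Sum>x\<in>V. \<Phi> P x * (g x)\<^sup>2)"
    unfolding sum.swap[of _ V T] \<Phi>_def local_twist_sum
    by (simp add: sum_distrib_left sum_distrib_right Gsum[OF finite_tiles])
  have "of_real (cos \<theta>) * (- 2 * \<i> * of_real (sin \<theta>) * of_nat n) =
      (\<Sum>S\<in>T. of_real (cos \<theta>) * (\<Sum>x\<in>V. \<Phi> S x * (g x)\<^sup>2))"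
    unfolding polygon[symmetric] total[symmetric] by (rule sum_distrib_left)
  also have "\<dots> = (\<Sum>S\<in>T. - 2 * \<i> * of_real (sin \<theta>) * of_real ((cmod (g (B S) - g (C S)))\<^sup>2))"
    by (rule sum.cong[OF refl tile])
  also have "\<dots> = - 2 * \<i> * of_real (sin \<theta>) * of_real (\<Sum>S\<in>T. (cmod (g (B S) - g (C S)))\<^sup>2)"
    unfolding of_real_sum by (rule sum_distrib_left[symmetric])
  \<comment> \<open>Cancelling \<open>sin \<theta>\<close>, which is nonzero, leaves a negative
    number equal to a sum of squares.\<close>
  finally have "of_real (cos \<theta> * real n) = complex_of_real (\<Sum>S\<in>T. (cmod (g (B S) - g (C S)))\<^sup>2)"
    using sin_ne by simp
  then have "cos \<theta> * real n = (\<Sum>S\<in>T. (cmod (g (B S) - g (C S)))\<^sup>2)" by (simp only: of_real_eq_iff)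
  moreover have "\<dots> \<ge> 0" by (intro sum_nonneg) simp
  moreover have "cos \<theta> * real n < 0" using cos_neg n5 by (simp add: mult_neg_pos)
  ultimately show False by linarith
qed

end

theorem theorem2:
  fixes n :: nat and P :: "complex set" and T :: "complex set set" and \<alpha> :: real
  assumes "n \<ge> 5" and "n \<noteq> 28"
    and "is_regular_ngon n P"
    and "is_tiling P T"
    and "similar_right_triangles T \<alpha>"
  shows "\<alpha> \<in> {pi / real n, 2 * pi / real n, pi / 6 + 2 * pi / (3 * real n)}"
proof -
  obtain z w where w: "w \<noteq> 0"
    and "P = convex hull ((\<lambda>k. z + w * cis (2 * pi * real k / real n)) ` {..<n})"
    using assms(3) unfolding is_regular_ngon_def by blast
  then have P: "P = convex hull (range (ngon_vertex n z w))"
    using range_ngon_vertex[of n z w] assms(1) by simp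
  have \<alpha>: "0 < \<alpha>" "\<alpha> \<le> pi / 4" and "\<forall>S\<in>T. has_triangle_angles S \<alpha> (pi / 2 - \<alpha>) (pi / 2)"
    using assms(5) unfolding similar_right_triangles_def by blast+
  then have "\<forall>S\<in>T. \<exists>a b c. \<not> collinear {a, b, c} \<and> S = convex hull {a, b, c} \<and>
      angle_at b a c = \<alpha> \<and> angle_at a b c = pi / 2 - \<alpha> \<and> angle_at a c b = pi / 2"
    unfolding has_triangle_angles_def by blast
  from this[unfolded bchoice_iff] obtain A B C where
    ABC: "\<forall>S\<in>T. \<not> collinear {A S, B S, C S} \<and> S = convex hull {A S, B S, C S} \<and>
      angle_at (B S) (A S) (C S) = \<alpha> \<and> angle_at (A S) (B S) (C S) = pi / 2 - \<alpha> \<and>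
      angle_at (A S) (C S) (B S) = pi / 2"
    by - (elim exE, rule that)
  interpret right_triangle_tiling T P \<alpha> A B C
  proof
    show "finite T" "\<Union>T = P"
      using assms(4) unfolding is_tiling_def by blast+
    show "interior S \<inter> interior S' = {}" if "S \<in> T" "S' \<in> T" "S \<noteq> S'" for S S'
      using assms(4) that unfolding is_tiling_def by blast
    fix S assume "S \<in> T"
    note tri = ABC[rule_format, OF this]
    show "\<not> collinear {A S, B S, C S}" by (rule tri[THEN conjunct1])
    note tri = tri[THEN conjunct2]
    show "S = convex hull {A S, B S, C S}" by (rule tri[THEN conjunct1])
    note tri = tri[THEN conjunct2]
    show "angle_at (B S) (A S) (C S) = \<alpha>" by (rule tri[THEN conjunct1])
    note tri = tri[THEN conjunct2]
    show "angle_at (A S) (B S) (C S) = pi / 2 - \<alpha>" by (rule tri[THEN conjunct1])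
    show "angle_at (A S) (C S) (B S) = pi / 2" by (rule tri[THEN conjunct2])
  qed
  show ?thesis
    using angle_cases[OF assms(1,2) w \<alpha> P] no_pentagon_heptagon[OF _ _ w P] by blast
qed

end
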